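(* Let $p\ge 1$ and let $\sigma\in\{-,+\}^p$ be a periodic slope itinerary containing exactly one $-$. Then the set of parameters $(a,b)\in\mathcal P=\mathbb R/\mathbb Z\times[0,1]$ for which $f_{a,b}$ has an attracting periodic cycle of period $p$ with periodic slope itinerary $\sigma$ is non-empty. Further, every connected component of this set of parameters is a tongue, i.e. the closure of the component intersects $\mathbb T\times\{1\}$ in a nontrivial (non-degenerate) interval.
   Context: Let $\mathbb T=\mathbb R/\mathbb Z$, identified with $[0,1]$ with $0\sim 1$. For $(a,b)\in\mathcal P=\mathbb R/\mathbb Z\times[0,1]$ define $f_{a,b}:\mathbb T\to\mathbb T$ by $f_{a,b}(x)=\left(2x+a+\frac b2 S(x)\right)\bmod 1$, where $S(x)=4x-1$ for $x\in[0,\frac12]$ and $S(x)=-4x+3$ for $x\in[\frac12,1)$. Write $I_+=[0,\frac12]$, $I_-=[\frac12,1]$. Thus $f_{a,b}$ has slope $2(1+b)$ on $I_+$ and $2(1-b)$ on $I_-$. For a periodic orbit $x_0,\dots,x_{p-1}$ (with $x_{j+1}=f_{a,b}(x_j)$) of exact period $p$ avoiding $0$ and $\frac12$, its periodic slope itinerary is $\sigma=(\sigma_0,\dots,\sigma_{p-1})\in\{-,+\}^p$ with $x_j\in I_{\sigma_j}$. A parameter $(a,b)$ has an orbit with itinerary $\sigma$ if some periodic orbit of exact period $p$, with a suitable choice of starting point, has this itinerary. A periodic cycle of period $p$ is attracting if each of its points has a neighbourhood all of whose points converge to it under iteration of $f_{a,b}^p$. A connected component $S$ of the set of parameters corresponding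 to attracting cycles with periodic slope itinerary $\sigma$ is called a tongue if $\overline S$ intersects $\mathbb T\times\{1\}$ in a nontrivial interval; otherwise it is called an eye. *)

theory Defs
  imports "HOL-Analysis.Analysis"
begin

lemma equivp_diff_Ints: "equivp (\<lambda>x y::real. x - y \<in> \<int>)"
proof (rule equivpI)
  show "reflp (\<lambda>x y::real. x - y \<in> \<int>)"
    by (auto intro: reflpI)
  show "symp (\<lambda>x y::real. x - y \<in> \<int>)"
    by (rule sympI) (metis Ints_minus minus_diff_eq)
  show "transp (\<lambda>x y::real. x - y \<in> \<int>)"
  proof (rule transpI)
    fix x y z :: real
    assume "x - y \<in> \<int>" "y - z \<in> \<int>"
    then have "(x - y) + (y - z) \<in> \<int>"
      by (rule Ints_add)
    then show "x - z \<in> \<int>"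
      by simp
  qed
qed

quotient_type circle = real / "\<lambda>x y::real. x - y \<in> \<int>"
  by (rule equivp_diff_Ints)

lift_definition circle_of :: "real \<Rightarrow> circle" is "\<lambda>t. t" .

(* The representative of a class lying in [0,1). *)
lift_definition coord :: "circle \<Rightarrow> real" is frac
proof -
  fix x y :: real
  assume "x - y \<in> \<int>"
  then obtain k where "x = y + of_int k"
    by (metis Ints_cases add.commute diff_eq_eq)
  then show "frac x = frac y"
    by (simp add: frac_def)
qed

(* The quotient topology of R/Z. *)
instantiation circle :: topological_space
begin

definition open_circle :: "circle set \<Rightarrow> bool" where
  "open_circle U \<longleftrightarrow> open (circle_of -` U)"

instance
  by standard (simp_all add: open_circle_def vimage_Union open_Int open_UN)

end

definition S_tent :: "real \<Rightarrow> real" where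
  "S_tent x = (if x \<le> 1/2 then 4 * x - 1 else - 4 * x + 3)"

definition f_ab :: "circle \<Rightarrow> real \<Rightarrow> circle \<Rightarrow> circle" where
  "f_ab a b x = circle_of (2 * coord x + coord a + b / 2 * S_tent (coord x))"

datatype slope = Minus | Plus

fun I_slope :: "slope \<Rightarrow> circle set" where
  "I_slope Plus = circle_of ` {0..1/2}"
| "I_slope Minus = circle_of ` {1/2..1}"

definition exact_period :: "('a \<Rightarrow> 'a) \<Rightarrow> nat \<Rightarrow> 'a \<Rightarrow> bool" where
  "exact_period g p x \<longleftrightarrow>
     0 < p \<and> (g ^^ p) x = x \<and> (\<forall>k. 0 < k \<and> k < p \<longrightarrow> (g ^^ k) x \<noteq> x)"

definition attracting_cycle :: "('a::topological_space \<Rightarrow> 'a) \<Rightarrow> nat \<Rightarrow> 'a \<Rightarrow> bool" where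
  "attracting_cycle g p x \<longleftrightarrow> exact_period g p x \<and>
     (\<forall>j<p. \<exists>U. open U \<and> (g ^^ j) x \<in> U \<and>
        (\<forall>y\<in>U. (\<lambda>n. ((g ^^ p) ^^ n) y) \<longlonglongrightarrow> (g ^^ j) x))"

(* x is the starting point of the orbit, whose points must avoid 0 and 1/2;
   the period is the length of the word. *)
definition has_itinerary :: "(circle \<Rightarrow> circle) \<Rightarrow> slope list \<Rightarrow> circle \<Rightarrow> bool" where
  "has_itinerary g \<sigma> x \<longleftrightarrow> exact_period g (length \<sigma>) x \<and>
     (\<forall>j<length \<sigma>. (g ^^ j) x \<notin> {circle_of 0, circle_of (1/2)} \<and> (g ^^ j) x \<in> I_slope (\<sigma> ! j))"

definition attracting_params :: "slope list \<Rightarrow> (circle \<times> real) set" where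
  "attracting_params \<sigma> = {(a, b). b \<in> {0..1} \<and>
     (\<exists>x. attracting_cycle (f_ab a b) (length \<sigma>) x \<and> has_itinerary (f_ab a b) \<sigma> x)}"

(* The interval in the circle may be taken compact, because the set on the left is;
   the closure may be taken in R/Z x R, in which the parameter space is closed. *)
definition is_tongue :: "(circle \<times> real) set \<Rightarrow> bool" where
  "is_tongue C \<longleftrightarrow> (\<exists>\<alpha> \<beta>. \<alpha> < \<beta> \<and> \<beta> < \<alpha> + 1 \<and>
     closure C \<inter> (UNIV \<times> {1}) = (\<lambda>t. (circle_of t, 1)) ` {\<alpha>..\<beta>})"

end

theory Submission
  imports Defs
begin

text \<open>The lift \<open>F\<close> of \<open>f\<close> has slope \<open>2 (1 - b)\<close> on \<open>I_-\<close> and \<open>2 (1 + b)\<close> on \<open>I_+\<close>, so a cycle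
  with exactly one point \<open>x\<close> in \<open>I_-\<close> has multiplier \<open>L(b) = 2 (1 - b) (2 (1 + b))^(p-1)\<close>, and it
  is attracting if and only if \<open>L(b) < 1\<close> (\<open>attracting_if_multiplier_less_1\<close>,
  \<open>multiplier_less_1_if_attracting\<close>). The set of \<open>b\<close> with \<open>L(b) < 1\<close> is an interval that ends
  at 1 (\<open>attracting_slopes_upward\<close>). It remains to understand the values of \<open>a\<close>.

  Since \<open>2 (1 + b)\<close> is a Lipschitz constant for \<open>F\<close>, the \<open>p\<close>-th iterate of \<open>F\<close> contracts
  \<^emph>\<open>all\<close> of \<open>I_-\<close> by the factor \<open>L(b) < 1\<close>. Therefore \<open>I_-\<close> contains at most one periodic
  point of period dividing \<open>p\<close> (\<open>periodic_point_unique_I_minus\<close>). This has two consequences.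
  The parameter determines the cycle. Moreover, the points of the cycle in \<open>I_+\<close> never meet the
  break points 0 and 1/2, because these are end points of \<open>I_-\<close> and would be a second periodic
  point there. So as long as \<open>L(b) < 1\<close>, a cycle can cease to have its itinerary only
  when \<open>x\<close> itself reaches an end point of \<open>I_-\<close>.

  To exploit this, parametrise by \<open>x\<close> and \<open>b\<close> instead of \<open>a\<close> and \<open>b\<close>. Once the integers \<open>k j\<close> that are
  dropped when reducing \<open>F\<close> modulo 1 are prescribed, the orbit is affine in \<open>a\<close>, and the condition
  that it closes up has a unique solution \<open>a = param p k x b\<close>. Whether the solution really has the
  required itinerary is, by the above, both an open and a closed condition on \<open>(x, b)\<close> in the
  connected set of all \<open>x\<close> in the interior of \<open>I_-\<close> and all \<open>b\<close> with \<open>L(b) < 1\<close>. Hence it holds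
  everywhere or nowhere (\<open>admissible_everywhere\<close>). The attracting parameters are thus a union of
  connected pieces, one for each admissible \<open>k\<close>. The pieces are relatively open (\<open>openin_piece\<close>), and any two of
  them are equal or disjoint (\<open>pieces_eq_or_disjoint\<close>), so they are the components. Each of them
  reaches \<open>b = 1\<close>, where its closure is the arc of the values \<open>param p k x 1\<close> for \<open>1/2 \<le> x \<le> 1\<close>
  (\<open>closure_piece\<close>). Finally, at \<open>b = 1\<close> the equations can be solved explicitly, which yields an
  admissible \<open>k\<close> (\<open>admissible_exists\<close>).\<close>

section \<open>The circle\<close>

lemma circle_of_eq_iff: "circle_of s = circle_of t \<longleftrightarrow> s - t \<in> \<int>"
  by transfer simp

lemma coord_circle_of: "coord (circle_of t) = frac t"
  by transfer simp

lemma circle_of_coord: "circle_of (coord c) = c"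
proof (transfer)
  fix c :: real
  show "frac c - c \<in> \<int>" by (simp add: frac_def)
qed

lemma coord_less_1: "coord c < 1"
  by transfer (rule frac_lt_1)

lemma circle_cases: obtains t where "c = circle_of t"
  using circle_of_coord[of c] by metis

lemma continuous_circle_of: "continuous_on UNIV circle_of"
  by (simp add: continuous_on_open_vimage open_circle_def)

lemma continuous_on_circle:
  fixes g :: "circle \<Rightarrow> 'a::topological_space"
  assumes "continuous_on UNIV (\<lambda>t. g (circle_of t))"
  shows "continuous_on UNIV g"
proof -
  have "open (g -` B)" if "open B" for B
  proof -
    have "open ((\<lambda>t. g (circle_of t)) -` B)"
      using assms that by (simp add: continuous_on_open_vimage)
    moreover have "(\<lambda>t. g (circle_of t)) -` B = circle_of -` (g -` B)"
      by auto
    ultimately show ?thesis by (simp add: open_circle_def)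
  qed
  then show ?thesis by (simp add: continuous_on_open_vimage)
qed

lemma open_circle_of_image:
  assumes "open V"
  shows "open (circle_of ` V)"
proof -
  have "circle_of -` circle_of ` V = (\<Union>n::int. (\<lambda>x. of_int n + x) ` V)"
  proof (intro set_eqI iffI)
    fix s assume "s \<in> circle_of -` circle_of ` V"
    then obtain t where "t \<in> V" "s - t \<in> \<int>"
      by (auto simp: circle_of_eq_iff)
    then obtain n :: int where "s = of_int n + t"
      by (metis Ints_cases diff_add_cancel)
    with \<open>t \<in> V\<close> show "s \<in> (\<Union>n::int. (\<lambda>x. of_int n + x) ` V)" by auto
  next
    fix s assume "s \<in> (\<Union>n::int. (\<lambda>x. of_int n + x) ` V)"
    then obtain n :: int and t where "t \<in> V" "s = of_int n + t" by auto
    then have "circle_of s = circle_of t" by (simp add: circle_of_eq_iff)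
    with \<open>t \<in> V\<close> show "s \<in> circle_of -` circle_of ` V" by auto
  qed
  moreover have "open (\<Union>n::int. (\<lambda>x. of_int n + x) ` V)"
    using assms by (intro open_UN ballI open_translation)
  ultimately show ?thesis by (simp add: open_circle_def)
qed

lemma open_circle_of_image_prod:
  fixes V :: "(real \<times> 'b::topological_space) set"
  assumes "open V"
  shows "open ((\<lambda>(t, b). (circle_of t, b)) ` V)"
proof (rule open_prod_intro)
  fix z assume "z \<in> (\<lambda>(t, b). (circle_of t, b)) ` V"
  then obtain t b where "(t, b) \<in> V" "z = (circle_of t, b)" by auto
  moreover from assms \<open>(t, b) \<in> V\<close> obtain A B where
    "open A" "open B" "(t, b) \<in> A \<times> B" "A \<times> B \<subseteq> V"
    by (rule open_prod_elim)
  ultimately show "\<exists>A B. open A \<and> open B \<and> z \<in> A \<times> B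
      \<and> A \<times> B \<subseteq> (\<lambda>(t, b). (circle_of t, b)) ` V"
    by (intro exI[of _ "circle_of ` A"] exI[of _ B])
      (force simp: open_circle_of_image)
qed

text \<open>Two classes \<open>s\<close>, \<open>t\<close> are separated by arcs of half the distance from \<open>s - t\<close> to
  the nearest integer.\<close>

instance circle :: t2_space
proof
  fix c d :: circle assume "c \<noteq> d"
  obtain s where s: "c = circle_of s" by (rule circle_cases)
  obtain t where t: "d = circle_of t" by (rule circle_cases)
  define r where "r = \<bar>s - t - of_int (round (s - t))\<bar>"
  have "s - t \<notin> \<int>" using \<open>c \<noteq> d\<close> s t by (simp add: circle_of_eq_iff)
  then have "r > 0" unfolding r_def
    by (metis Ints_of_int diff_eq_diff_eq diff_self zero_less_abs_iff)
  have far: "r \<le> \<bar>s - t - of_int n\<bar>" for n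
    unfolding r_def by (rule round_diff_minimal)
  have "circle_of ` ball s (r/2) \<inter> circle_of ` ball t (r/2) = {}"
  proof (rule ccontr)
    assume "circle_of ` ball s (r/2) \<inter> circle_of ` ball t (r/2) \<noteq> {}"
    then obtain s' t' where *: "\<bar>s - s'\<bar> < r/2" "\<bar>t - t'\<bar> < r/2" "s' - t' \<in> \<int>"
      by (auto simp: circle_of_eq_iff dist_real_def)
    then obtain n where "s' - t' = of_int n" by (auto elim: Ints_cases)
    with * far[of n] show False by linarith
  qed
  moreover have "c \<in> circle_of ` ball s (r/2)" "d \<in> circle_of ` ball t (r/2)"
    using s t \<open>r > 0\<close> by auto
  ultimately show "\<exists>U V. open U \<and> open V \<and> c \<in> U \<and> d \<in> V \<and> U \<inter> V = {}"
    by (intro exI[of _ "circle_of ` ball s (r/2)"] exI[of _ "circle_of ` ball t (r/2)"] conjI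
        open_circle_of_image open_ball)
qed

section \<open>The lift to the line\<close>

definition lift :: "real \<Rightarrow> real \<Rightarrow> real \<Rightarrow> real" where
  "lift a b t = 2 * t + a + b / 2 * S_tent (frac t)"

lemma f_ab_circle_of: "f_ab (circle_of a) b (circle_of t) = circle_of (lift a b t)"
proof -
  have "2 * frac t + frac a + b / 2 * S_tent (frac t) - lift a b t
      = of_int (- 2 * \<lfloor>t\<rfloor> - \<lfloor>a\<rfloor>)"
    by (simp add: lift_def frac_def)
  then show ?thesis
    by (simp only: f_ab_def coord_circle_of circle_of_eq_iff Ints_of_int)
qed

lemma funpow_f_ab_circle_of:
  "(f_ab (circle_of a) b ^^ n) (circle_of t) = circle_of ((lift a b ^^ n) t)"
  by (induction n) (simp_all add: f_ab_circle_of)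

lemma lift_I_plus:
  assumes "0 \<le> t" "t \<le> 1/2"
  shows "lift a b t = 2 * (1 + b) * t - b / 2 + a"
proof -
  have "frac t = t" using assms by (simp add: frac_eq)
  with assms show ?thesis by (simp add: lift_def S_tent_def algebra_simps)
qed

lemma lift_I_minus:
  assumes "1/2 \<le> t" "t \<le> 1"
  shows "lift a b t = 2 * (1 - b) * t + 3 * b / 2 + a"
proof (cases "t = 1")
  case True
  then show ?thesis by (simp add: lift_def S_tent_def algebra_simps)
next
  case False
  then have "frac t = t" using assms by (simp add: frac_eq)
  with assms show ?thesis by (auto simp: lift_def S_tent_def algebra_simps)
qed

lemma S_tent_frac: "S_tent (frac t) = 4 * \<bar>t - of_int (round t)\<bar> - 1"
proof (cases "frac t \<ge> 1/2")
  case True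
  then have "t \<noteq> of_int \<lfloor>t\<rfloor>" by (auto simp: frac_def)
  then have "of_int (round t) = of_int \<lfloor>t\<rfloor> + (1::real)"
    using True by (simp add: round_altdef ceiling_altdef)
  then show ?thesis using True frac_lt_1[of t]
    by (auto simp: S_tent_def frac_def abs_if)
next
  case False
  then have "round t = \<lfloor>t\<rfloor>" by (simp add: round_altdef)
  then show ?thesis using False of_int_floor_le[of t]
    by (auto simp: S_tent_def frac_def)
qed

text \<open>Up to affine rescaling, \<open>S\<close> is the distance to the nearest integer, and is therefore
  Lipschitz.\<close>

lemma S_tent_frac_lipschitz: "\<bar>S_tent (frac s) - S_tent (frac t)\<bar> \<le> 4 * \<bar>s - t\<bar>"
proof -
  have "\<bar>u - of_int (round u)\<bar> \<le> \<bar>u - v\<bar> + \<bar>v - of_int (round v)\<bar>" for u v :: real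
    using round_diff_minimal[of u "round v"] by linarith
  from this[of s t] this[of t s] show ?thesis
    unfolding S_tent_frac abs_minus_commute[of t s] by (intro abs_leI) simp_all
qed

lemma lift_lipschitz:
  assumes "0 \<le> b"
  shows "\<bar>lift a b s - lift a b t\<bar> \<le> 2 * (1 + b) * \<bar>s - t\<bar>"
proof -
  have "lift a b s - lift a b t = 2 * (s - t) + b / 2 * (S_tent (frac s) - S_tent (frac t))"
    by (simp add: lift_def algebra_simps)
  also have "\<bar>\<dots>\<bar> \<le> 2 * \<bar>s - t\<bar> + b / 2 * \<bar>S_tent (frac s) - S_tent (frac t)\<bar>"
    using assms abs_triangle_ineq[of "2 * (s - t)" "b / 2 * (S_tent (frac s) - S_tent (frac t))"]
    by (simp only: abs_mult abs_numeral abs_divide abs_of_nonneg)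
  also have "\<dots> \<le> 2 * \<bar>s - t\<bar> + b / 2 * (4 * \<bar>s - t\<bar>)"
    using assms by (intro add_left_mono mult_left_mono S_tent_frac_lipschitz) auto
  finally show ?thesis by (simp add: algebra_simps)
qed

lemma continuous_lift:
  assumes "0 \<le> b"
  shows "continuous_on UNIV (lift a b)"
proof -
  have "(2 * (1 + b))-lipschitz_on UNIV (lift a b)"
    using assms lift_lipschitz[of b a]
    by (intro lipschitz_onI) (auto simp: dist_real_def)
  then show ?thesis by (rule lipschitz_on_continuous_on)
qed

lemma inj_lift:
  assumes "0 \<le> b" "b < 1"
  shows "inj (lift a b)"
proof (rule injI)
  fix s t assume "lift a b s = lift a b t"
  then have "2 * (s - t) = b / 2 * (S_tent (frac t) - S_tent (frac s))"
    by (simp add: lift_def algebra_simps)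
  then have "\<bar>2 * (s - t)\<bar> = \<bar>b / 2 * (S_tent (frac t) - S_tent (frac s))\<bar>"
    by (rule arg_cong)
  then have "2 * \<bar>s - t\<bar> = b / 2 * \<bar>S_tent (frac t) - S_tent (frac s)\<bar>"
    using assms(1) by (simp only: abs_mult abs_numeral abs_divide abs_of_nonneg)
  also have "\<dots> \<le> b / 2 * (4 * \<bar>t - s\<bar>)"
    using assms by (intro mult_left_mono S_tent_frac_lipschitz) auto
  finally have "(1 - b) * \<bar>s - t\<bar> \<le> 0"
    by (simp add: left_diff_distrib abs_minus_commute[of t s])
  then show "s = t" using assms by (simp add: mult_le_0_iff)
qed

lemma continuous_funpow:
  fixes g :: "'a::topological_space \<Rightarrow> 'a"
  assumes "continuous_on UNIV g"
  shows "continuous_on UNIV (g ^^ n)"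
proof (induction n)
  case 0
  then show ?case by (simp add: id_def)
next
  case (Suc n)
  show ?case
    using continuous_on_compose2[OF assms Suc] by (simp add: o_def)
qed

lemma continuous_f_ab:
  assumes "0 \<le> b"
  shows "continuous_on UNIV (f_ab a b)"
proof -
  obtain r where r: "a = circle_of r" by (rule circle_cases)
  show ?thesis
  proof (rule continuous_on_circle)
    show "continuous_on UNIV (\<lambda>t. f_ab a b (circle_of t))"
      unfolding r f_ab_circle_of
      by (rule continuous_on_compose2[OF continuous_circle_of continuous_lift[OF assms]]) simp
  qed
qed

section \<open>Cycles that visit \<open>I_-\<close> once\<close>

text \<open>The derivative of the \<open>p\<close>-th iterate along an orbit that is in \<open>I_-\<close> exactly once.\<close>

definition multiplier :: "nat \<Rightarrow> real \<Rightarrow> real" where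
  "multiplier p b = 2 * (1 - b) * (2 * (1 + b)) ^ (p - 1)"

text \<open>Only the first step takes place on \<open>I_-\<close>, where the slope is known exactly; the later
  steps stretch by at most the Lipschitz constant \<open>2 (1 + b)\<close>. The bound is thus valid on all
  of \<open>I_-\<close>, wherever the images of the interval lie.\<close>

lemma lift_contraction_I_minus:
  assumes b: "0 \<le> b" "b \<le> 1" and p: "p \<ge> 1"
    and s: "s \<in> {1/2..1}" and t: "t \<in> {1/2..1}"
  shows "\<bar>(lift a b ^^ p) s - (lift a b ^^ p) t\<bar> \<le> multiplier p b * \<bar>s - t\<bar>"
  using p
proof (induction p rule: dec_induct)
  case base
  have "lift a b s - lift a b t = 2 * (1 - b) * (s - t)"
    using s t by (simp add: lift_I_minus algebra_simps)
  then show ?case using b by (simp add: multiplier_def abs_mult)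
next
  case (step n)
  have "\<bar>(lift a b ^^ Suc n) s - (lift a b ^^ Suc n) t\<bar>
      \<le> 2 * (1 + b) * \<bar>(lift a b ^^ n) s - (lift a b ^^ n) t\<bar>"
    using lift_lipschitz[OF b(1)] by simp
  also have "\<dots> \<le> 2 * (1 + b) * (multiplier n b * \<bar>s - t\<bar>)"
    using step b by (intro mult_left_mono) auto
  also have "\<dots> = multiplier (Suc n) b * \<bar>s - t\<bar>"
    using step.hyps by (cases n) (simp_all add: multiplier_def)
  finally show ?case .
qed

text \<open>This carries the whole proof. If the multiplier is below 1, then the \<open>p\<close>-th iterate
  contracts \<open>I_-\<close>, so two fixed points of it in \<open>I_-\<close> coincide; a nonzero integer shift between
  the lifts cannot interfere, since \<open>I_-\<close> has length 1/2. As the break points 0 and 1/2 are the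
  end points of \<open>I_-\<close>, they cannot be periodic of period \<open>p\<close> once there is such a point in
  the interior.\<close>

lemma periodic_point_unique_I_minus:
  assumes b: "0 \<le> b" "b \<le> 1" and p: "p \<ge> 1" and m: "multiplier p b < 1"
    and s: "s \<in> {1/2..1}" "(f_ab a b ^^ p) (circle_of s) = circle_of s"
    and t: "t \<in> {1/2..1}" "(f_ab a b ^^ p) (circle_of t) = circle_of t"
  shows "s = t"
proof -
  obtain r where r: "a = circle_of r" by (rule circle_cases)
  obtain j where j: "(lift r b ^^ p) s - s = of_int j"
    using s(2) by (auto simp: r funpow_f_ab_circle_of circle_of_eq_iff elim: Ints_cases)
  obtain k where k: "(lift r b ^^ p) t - t = of_int k"
    using t(2) by (auto simp: r funpow_f_ab_circle_of circle_of_eq_iff elim: Ints_cases)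
  have "\<bar>s - t\<bar> \<le> \<bar>s - t + of_int (j - k)\<bar>"
  proof (cases "j = k")
    case False
    then have "\<bar>of_int (j - k)\<bar> \<ge> (1::real)"
      by linarith
    moreover have "\<bar>s - t\<bar> \<le> 1/2" using s t by (auto simp: abs_if)
    ultimately show ?thesis by linarith
  qed simp
  also have "s - t + of_int (j - k) = (lift r b ^^ p) s - (lift r b ^^ p) t"
    using j k by simp
  also have "\<bar>\<dots>\<bar> \<le> multiplier p b * \<bar>s - t\<bar>"
    by (rule lift_contraction_I_minus[OF b p s(1) t(1)])
  finally have "(1 - multiplier p b) * \<bar>s - t\<bar> \<le> 0" by (simp add: algebra_simps)
  then show "s = t" using m by (simp add: mult_le_0_iff)
qed

section \<open>Attraction is decided by the multiplier\<close>

lemma funpow_commute: "(g ^^ m) ((g ^^ n) x) = (g ^^ n) ((g ^^ m) x)"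
  by (metis add.commute comp_apply funpow_add)

text \<open>Going from \<open>g\<^sup>i x\<close> on to the next multiple of the period returns to \<open>x\<close>, so
  iterates of \<open>g\<close> carry statements between any two points of the cycle.\<close>

lemma funpow_return:
  assumes "exact_period g p x"
  shows "(g ^^ ((p - 1) * i)) ((g ^^ i) x) = x"
proof -
  have gp: "(g ^^ p) x = x" and "p > 0" using assms by (auto simp: exact_period_def)
  have "((g ^^ p) ^^ i) x = x" by (induction i) (simp_all add: gp)
  moreover have "(p - 1) * i + i = p * i" using \<open>p > 0\<close> by (cases p) auto
  ultimately show ?thesis
    by (metis comp_apply funpow_add funpow_mult)
qed

lemma exact_period_funpow:
  assumes "exact_period g p x"
  shows "exact_period g p ((g ^^ i) x)"
proof -
  define l where "l = (p - 1) * i"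
  have ret: "(g ^^ l) ((g ^^ i) x) = x" unfolding l_def by (rule funpow_return[OF assms])
  have "(g ^^ k) x = x" if "(g ^^ k) ((g ^^ i) x) = (g ^^ i) x" for k
    using that ret by (metis funpow_commute)
  then show ?thesis
    using assms unfolding exact_period_def by (metis funpow_commute)
qed

text \<open>A basin neighbourhood of one point of the cycle pulls back, under the iterate that leads
  to that point, to basin neighbourhoods of all the others.\<close>

lemma attracting_cycle_funpow:
  assumes g: "continuous_on UNIV g" and x: "exact_period g p x"
    and U: "open U" "x \<in> U" "\<And>y. y \<in> U \<Longrightarrow> (\<lambda>n. ((g ^^ p) ^^ n) y) \<longlonglongrightarrow> x"
  shows "attracting_cycle g p ((g ^^ i) x)"
proof -
  have "\<exists>V. open V \<and> (g ^^ i) x \<in> V \<and> (\<forall>y\<in>V. (\<lambda>n. ((g ^^ p) ^^ n) y) \<longlonglongrightarrow> (g ^^ i) x)" for i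
  proof (intro exI conjI ballI)
    define l where "l = (p - 1) * i"
    show "open ((g ^^ l) -` U)"
      using continuous_funpow[OF g] U(1) by (simp add: continuous_on_open_vimage)
    show "(g ^^ i) x \<in> (g ^^ l) -` U"
      using U(2) funpow_return[OF x] by (simp add: l_def)
    fix y assume "y \<in> (g ^^ l) -` U"
    then have "(\<lambda>n. ((g ^^ p) ^^ n) ((g ^^ l) y)) \<longlonglongrightarrow> x" using U(3) by simp
    then have "(\<lambda>n. (g ^^ i) (((g ^^ p) ^^ n) ((g ^^ l) y))) \<longlonglongrightarrow> (g ^^ i) x"
      by (rule continuous_on_tendsto_compose[OF continuous_funpow[OF g]]) auto
    moreover have "i + p * n + l = p * (n + i)" for n
      using x by (cases p) (auto simp: l_def exact_period_def algebra_simps)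
    then have "(g ^^ i) (((g ^^ p) ^^ n) ((g ^^ l) y)) = ((g ^^ p) ^^ (n + i)) y" for n
      by (metis comp_apply funpow_add funpow_mult)
    ultimately have "(\<lambda>n. ((g ^^ p) ^^ (n + i)) y) \<longlonglongrightarrow> (g ^^ i) x" by simp
    then show "(\<lambda>n. ((g ^^ p) ^^ n) y) \<longlonglongrightarrow> (g ^^ i) x" by (rule LIMSEQ_offset)
  qed
  note * = this
  have "\<exists>V. open V \<and> (g ^^ j) ((g ^^ i) x) \<in> V
      \<and> (\<forall>y\<in>V. (\<lambda>n. ((g ^^ p) ^^ n) y) \<longlonglongrightarrow> (g ^^ j) ((g ^^ i) x))" for j
    using *[of "j + i"] by (simp add: funpow_add)
  then show ?thesis
    using exact_period_funpow[OF x] unfolding attracting_cycle_def by blast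
qed

lemma multiplier_nonneg: "0 \<le> b \<Longrightarrow> b \<le> 1 \<Longrightarrow> 0 \<le> multiplier p b"
  by (simp add: multiplier_def)

lemma multiplier_Suc: "n \<ge> 1 \<Longrightarrow> multiplier (Suc n) b = 2 * (1 + b) * multiplier n b"
  by (cases n) (simp_all add: multiplier_def)

lemma attracting_if_multiplier_less_1:
  assumes b: "0 \<le> b" "b \<le> 1" and p: "p \<ge> 1" and m: "multiplier p b < 1"
    and x: "1/2 < x" "x < 1" and per: "(f_ab a b ^^ p) (circle_of x) = circle_of x"
  shows "\<exists>U. open U \<and> circle_of x \<in> U
    \<and> (\<forall>y\<in>U. (\<lambda>n. ((f_ab a b ^^ p) ^^ n) y) \<longlonglongrightarrow> circle_of x)"
proof -
  obtain r where r: "a = circle_of r" by (rule circle_cases)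
  obtain K where K: "(lift r b ^^ p) x - x = of_int K"
    using per by (auto simp: r funpow_f_ab_circle_of circle_of_eq_iff elim: Ints_cases)
  define L where "L = multiplier p b"
  have L: "0 \<le> L" "L < 1" using multiplier_nonneg b m by (auto simp: L_def)
  \<comment> \<open>A neighbourhood symmetric about \<open>x\<close>, so that a contraction towards \<open>x\<close> preserves it.\<close>
  define d where "d = min (x - 1/2) (1 - x)"
  have "d > 0" using x by (simp add: d_def)
  have step: "\<exists>t'\<in>ball x d. (f_ab a b ^^ p) (circle_of t) = circle_of t' \<and> \<bar>t' - x\<bar> \<le> L * \<bar>t - x\<bar>"
    if "t \<in> ball x d" for t
  proof
    let ?t = "(lift r b ^^ p) t - of_int K"
    have tx: "t \<in> {1/2..1}" "x \<in> {1/2..1}" "\<bar>t - x\<bar> < d"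
      using that x by (auto simp: d_def dist_real_def abs_if split: if_splits)
    have diff: "?t - x = (lift r b ^^ p) t - (lift r b ^^ p) x" using K by simp
    have *: "\<bar>?t - x\<bar> \<le> L * \<bar>t - x\<bar>"
      unfolding L_def diff by (rule lift_contraction_I_minus[OF b p tx(1,2)])
    also have "\<dots> \<le> 1 * \<bar>t - x\<bar>" using L by (intro mult_right_mono) auto
    finally show "?t \<in> ball x d" using tx(3) by (auto simp: dist_real_def)
    show "(f_ab a b ^^ p) (circle_of t) = circle_of ?t \<and> \<bar>?t - x\<bar> \<le> L * \<bar>t - x\<bar>"
      using * by (simp add: r funpow_f_ab_circle_of circle_of_eq_iff)
  qed
  have conv: "(\<lambda>n. ((f_ab a b ^^ p) ^^ n) (circle_of t)) \<longlonglongrightarrow> circle_of x"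
    if t: "t \<in> ball x d" for t
  proof -
    have "\<exists>t'\<in>ball x d. ((f_ab a b ^^ p) ^^ n) (circle_of t) = circle_of t'
        \<and> \<bar>t' - x\<bar> \<le> L ^ n * \<bar>t - x\<bar>" for n
    proof (induction n)
      case 0
      then show ?case using t by auto
    next
      case (Suc n)
      then obtain s where s: "s \<in> ball x d"
        "((f_ab a b ^^ p) ^^ n) (circle_of t) = circle_of s" "\<bar>s - x\<bar> \<le> L ^ n * \<bar>t - x\<bar>"
        by blast
      obtain s' where s': "s' \<in> ball x d" "(f_ab a b ^^ p) (circle_of s) = circle_of s'"
        "\<bar>s' - x\<bar> \<le> L * \<bar>s - x\<bar>"
        using step[OF s(1)] by blast
      have "\<bar>s' - x\<bar> \<le> L * (L ^ n * \<bar>t - x\<bar>)"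
        using s'(3) mult_left_mono[OF s(3) L(1)] by linarith
      then show ?case using s s' by (auto simp: mult.assoc)
    qed
    then obtain u where u: "\<And>n. ((f_ab a b ^^ p) ^^ n) (circle_of t) = circle_of (u n)"
      "\<And>n. \<bar>u n - x\<bar> \<le> L ^ n * \<bar>t - x\<bar>"
      by metis
    have "(\<lambda>n. L ^ n * \<bar>t - x\<bar>) \<longlonglongrightarrow> 0"
      using L by (intro tendsto_mult_left_zero LIMSEQ_power_zero) auto
    then have "(\<lambda>n. u n - x) \<longlonglongrightarrow> 0"
      by (rule Lim_null_comparison[rotated]) (simp add: u(2))
    then have "u \<longlonglongrightarrow> x" by (simp add: LIM_zero_iff)
    then have "(\<lambda>n. circle_of (u n)) \<longlonglongrightarrow> circle_of x"
      by (rule continuous_on_tendsto_compose[OF continuous_circle_of]) auto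
    then show ?thesis by (simp add: u(1))
  qed
  show ?thesis
  proof (intro exI conjI ballI)
    show "open (circle_of ` ball x d)" by (rule open_circle_of_image) simp
    show "circle_of x \<in> circle_of ` ball x d" using \<open>d > 0\<close> by simp
  qed (auto intro: conv)
qed

lemma lift_add_of_int: "lift a b (t + of_int n) = lift a b t + 2 * of_int n"
proof -
  have "frac (t + of_int n) = frac t" by (simp add: frac_def)
  then show ?thesis by (simp add: lift_def)
qed

lemma eventually_lift_I_plus:
  assumes "0 < frac u" "frac u < 1/2"
  shows "\<forall>\<^sub>F v in nhds u. lift a b v - lift a b u = 2 * (1 + b) * (v - u)"
proof -
  let ?n = "\<lfloor>u\<rfloor>"
  have *: "lift a b v = 2 * (1 + b) * (v - ?n) - b / 2 + a + 2 * ?n"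
    if "v \<in> {of_int ?n<..<of_int ?n + 1/2}" for v
    using that lift_add_of_int[of a b "v - ?n" ?n] lift_I_plus[of "v - ?n" a b] by simp
  have u: "u \<in> {of_int ?n<..<of_int ?n + 1/2}"
    using assms by (auto simp: frac_def)
  have "\<forall>\<^sub>F v in nhds u. v \<in> {of_int ?n<..<of_int ?n + 1/2}"
    using u by (intro eventually_nhds_in_open) auto
  then show ?thesis
    by (rule eventually_mono) (simp only: * u, simp add: algebra_simps)
qed

lemma eventually_lift_I_minus:
  assumes "1/2 < u" "u < 1"
  shows "\<forall>\<^sub>F v in nhds u. lift a b v - lift a b u = 2 * (1 - b) * (v - u)"
proof -
  have "\<forall>\<^sub>F v in nhds u. v \<in> {1/2<..<1}"
    using assms by (intro eventually_nhds_in_open) auto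
  then show ?thesis
    by (rule eventually_mono) (use assms in \<open>simp add: lift_I_minus algebra_simps\<close>)
qed

text \<open>The distance in \<open>\<real>/\<int>\<close>, that is, from a difference of representatives to the nearest
  integer.\<close>

definition arc_dist :: "circle \<Rightarrow> circle \<Rightarrow> real" where
  "arc_dist c d = \<bar>coord c - coord d - of_int (round (coord c - coord d))\<bar>"

lemma dist_round_cong:
  fixes s t :: real
  assumes "s - t \<in> \<int>"
  shows "\<bar>s - of_int (round s)\<bar> = \<bar>t - of_int (round t)\<bar>"
proof -
  obtain n where n: "s - t = of_int n" using assms by (auto elim: Ints_cases)
  show ?thesis
    using round_diff_minimal[of s "round t + n"] round_diff_minimal[of t "round s - n"] n
    by (simp add: algebra_simps)
qed

lemma arc_dist_circle_of: "arc_dist (circle_of s) (circle_of t) = \<bar>s - t - of_int (round (s - t))\<bar>"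
proof -
  have "frac s - frac t - (s - t) = of_int (\<lfloor>t\<rfloor> - \<lfloor>s\<rfloor>)"
    by (simp add: frac_def)
  then have "frac s - frac t - (s - t) \<in> \<int>" by (simp only: Ints_of_int)
  then show ?thesis unfolding arc_dist_def coord_circle_of by (rule dist_round_cong)
qed

lemma dist_round_small:
  fixes e :: real
  assumes "\<bar>e\<bar> \<le> 1/2"
  shows "\<bar>e - of_int (round e)\<bar> = \<bar>e\<bar>"
proof (cases "round e = 0")
  case False
  then have "\<bar>of_int (round e)\<bar> \<ge> (1::real)" by linarith
  then show ?thesis using assms round_diff_minimal[of e 0] by simp
qed simp

lemma continuous_arc_dist: "continuous_on UNIV (\<lambda>c. arc_dist c d)"
proof (rule continuous_on_circle)
  obtain s where s: "d = circle_of s" by (rule circle_cases)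
  have "(\<lambda>t. arc_dist (circle_of t) d) = (\<lambda>t. (S_tent (frac (t - s)) + 1) / 4)"
    by (simp add: s arc_dist_circle_of S_tent_frac)
  moreover have "4-lipschitz_on UNIV (\<lambda>t. S_tent (frac (t - s)))"
  proof (rule lipschitz_onI)
    fix t u :: real
    show "dist (S_tent (frac (t - s))) (S_tent (frac (u - s))) \<le> 4 * dist t u"
      using S_tent_frac_lipschitz[of "t - s" "u - s"] by (simp add: dist_real_def)
  qed simp
  then have "continuous_on UNIV (\<lambda>t. S_tent (frac (t - s)))"
    by (rule lipschitz_on_continuous_on)
  ultimately show "continuous_on UNIV (\<lambda>t. arc_dist (circle_of t) d)"
    by (simp only:) (intro continuous_intros, auto)
qed

lemma arc_dist_eq_0_iff: "arc_dist c d = 0 \<longleftrightarrow> c = d"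
proof -
  obtain s where s: "c = circle_of s" by (rule circle_cases)
  obtain t where t: "d = circle_of t" by (rule circle_cases)
  show ?thesis
  proof
    assume "arc_dist c d = 0"
    then have "s - t = of_int (round (s - t))" by (simp add: s t arc_dist_circle_of)
    then show "c = d" unfolding s t circle_of_eq_iff by (metis Ints_of_int)
  qed (simp add: arc_dist_def)
qed

text \<open>If the multiplier is at least 1, then near \<open>x\<close> the \<open>p\<close>-th iterate is affine and does
  not decrease the distance to \<open>x\<close>. An orbit can then converge to \<open>x\<close> only by landing on it
  exactly. But the multiplier vanishes for \<open>b = 1\<close>, so \<open>b < 1\<close>, the lift is injective, and only
  countably many points ever land on \<open>x\<close>. Counting also disposes of orbits that leave the
  neighbourhood, travel around the circle and come back.\<close>

lemma multiplier_less_1_if_attracting: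
  assumes b: "0 \<le> b" "b \<le> 1" and p: "p \<ge> 1" and x: "1/2 < x" "x < 1"
    and itin: "\<And>j. 1 \<le> j \<Longrightarrow> j < p \<Longrightarrow>
      0 < coord ((f_ab a b ^^ j) (circle_of x)) \<and> coord ((f_ab a b ^^ j) (circle_of x)) < 1/2"
    and per: "(f_ab a b ^^ p) (circle_of x) = circle_of x"
    and U: "open U" "circle_of x \<in> U"
      "\<And>y. y \<in> U \<Longrightarrow> (\<lambda>n. ((f_ab a b ^^ p) ^^ n) y) \<longlonglongrightarrow> circle_of x"
  shows "multiplier p b < 1"
proof (rule ccontr)
  define L where "L = multiplier p b"
  assume "\<not> multiplier p b < 1"
  then have L: "L \<ge> 1" by (simp add: L_def)
  then have "b < 1" using b by (cases "b = 1") (auto simp: L_def multiplier_def)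
  obtain r where r: "a = circle_of r" by (rule circle_cases)
  obtain K where K: "(lift r b ^^ p) x - x = of_int K"
    using per by (auto simp: r funpow_f_ab_circle_of circle_of_eq_iff elim: Ints_cases)

  have "\<forall>\<^sub>F t in nhds x. (lift r b ^^ n) t - (lift r b ^^ n) x = multiplier n b * (t - x)"
    if "1 \<le> n" "n \<le> p" for n
    using that
  proof (induction n rule: dec_induct)
    case base
    then show ?case using eventually_lift_I_minus[OF x] by (simp add: multiplier_def)
  next
    case (step n)
    let ?u = "(lift r b ^^ n) x"
    have "isCont (lift r b ^^ n) x"
      using continuous_funpow[OF continuous_lift[OF b(1)]]
      by (simp add: continuous_on_eq_continuous_at)
    then have lim: "filterlim (lift r b ^^ n) (nhds ?u) (nhds x)"
      by (simp add: isCont_def tendsto_at_iff_tendsto_nhds)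
    have "0 < frac ?u" "frac ?u < 1/2"
      using itin[of n] step by (auto simp: r funpow_f_ab_circle_of coord_circle_of)
    then have "\<forall>\<^sub>F v in nhds ?u. lift r b v - lift r b ?u = 2 * (1 + b) * (v - ?u)"
      by (rule eventually_lift_I_plus)
    then have "\<forall>\<^sub>F t in nhds x.
        lift r b ((lift r b ^^ n) t) - lift r b ?u = 2 * (1 + b) * ((lift r b ^^ n) t - ?u)"
      using lim by (rule eventually_compose_filterlim)
    moreover have "\<forall>\<^sub>F t in nhds x. (lift r b ^^ n) t - ?u = multiplier n b * (t - x)"
      using step by simp
    ultimately show ?case
      by eventually_elim (use step in \<open>simp add: multiplier_Suc\<close>)
  qed
  from this[of p] p obtain d where d: "d > 0"
    "\<And>t. dist t x < d \<Longrightarrow> (lift r b ^^ p) t - (lift r b ^^ p) x = L * (t - x)"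
    unfolding eventually_nhds_metric L_def by blast

  define h where "h c = arc_dist c (circle_of x)" for c
  \<comment> \<open>Within distance \<open>1 / (2 L)\<close>, the image is at most half a turn away from \<open>x\<close>,
    so arc distance and distance on the line agree.\<close>
  define e where "e = min d (1 / (2 * L))"
  have "e > 0" using d L by (simp add: e_def)
  have expand: "h c \<le> h ((f_ab a b ^^ p) c)" if "h c < e" for c
  proof -
    obtain s where s: "c = circle_of s" by (rule circle_cases)
    define u where "u = s - x - of_int (round (s - x))"
    have u: "\<bar>u\<bar> = h c" by (simp add: u_def s h_def arc_dist_circle_of)
    have c: "c = circle_of (x + u)" by (simp add: s u_def circle_of_eq_iff)
    have "(f_ab a b ^^ p) c = circle_of ((lift r b ^^ p) (x + u))"
      by (simp add: c r funpow_f_ab_circle_of)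
    also have "(lift r b ^^ p) (x + u) = x + L * u + of_int K"
      using d(2)[of "x + u"] u that K by (simp add: e_def dist_real_def)
    also have "circle_of (x + L * u + of_int K) = circle_of (x + L * u)"
      by (simp add: circle_of_eq_iff)
    finally have "h ((f_ab a b ^^ p) c) = \<bar>L * u - of_int (round (L * u))\<bar>"
      by (simp add: h_def arc_dist_circle_of)
    also have "\<dots> = \<bar>L * u\<bar>"
    proof (rule dist_round_small)
      have "L * \<bar>u\<bar> \<le> L * (1 / (2 * L))"
        using u that L by (intro mult_left_mono) (auto simp: e_def)
      then show "\<bar>L * u\<bar> \<le> 1/2" using L by (simp add: abs_mult)
    qed
    also have "\<dots> \<ge> \<bar>u\<bar>" using L mult_right_mono[of 1 L "\<bar>u\<bar>"] by (simp add: abs_mult)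
    finally show ?thesis using u by simp
  qed

  have hits: "\<exists>N. ((f_ab a b ^^ p) ^^ N) y = circle_of x" if "y \<in> U" for y
  proof -
    define c where "c n = ((f_ab a b ^^ p) ^^ n) y" for n
    have "c \<longlonglongrightarrow> circle_of x" unfolding c_def using U(3)[OF that] .
    then have "(\<lambda>n. h (c n)) \<longlonglongrightarrow> h (circle_of x)"
      unfolding h_def by (rule continuous_on_tendsto_compose[OF continuous_arc_dist]) auto
    moreover have "h (circle_of x) = 0" by (simp add: h_def arc_dist_eq_0_iff)
    ultimately have lim: "(\<lambda>n. h (c n)) \<longlonglongrightarrow> 0" by simp
    then have "\<forall>\<^sub>F n in sequentially. h (c n) < e"
      using \<open>e > 0\<close> by (rule order_tendstoD)
    then obtain N where N: "\<And>n. n \<ge> N \<Longrightarrow> h (c n) < e"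
      unfolding eventually_sequentially by blast
    have "h (c N) \<le> h (c n)" if "n \<ge> N" for n
      using that
    proof (induction n rule: dec_induct)
      case (step n)
      then show ?case using expand[of "c n"] N[of n] by (simp add: c_def)
    qed simp
    then have "h (c N) \<le> 0" using lim by (intro LIMSEQ_le_const[OF lim]) auto
    moreover have "h (c N) \<ge> 0" by (simp add: h_def arc_dist_def)
    ultimately have "c N = circle_of x" using arc_dist_eq_0_iff by (simp add: h_def)
    then show ?thesis by (auto simp: c_def)
  qed

  have "open (circle_of -` U)" using U(1) by (simp add: open_circle_def)
  then obtain q where q: "q > 0" "ball x q \<subseteq> circle_of -` U"
    using U(2) by (meson openE vimageI)
  define Z where "Z = {s. s - x \<in> \<int>}"
  have "Z = range (\<lambda>n::int. x + of_int n)"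
    by (auto simp: Z_def elim!: Ints_cases) (metis add_diff_cancel_left' diff_add_cancel rangeI add.commute)
  then have "countable Z" by simp
  have "ball x q \<subseteq> (\<Union>N. (lift r b ^^ (p * N)) -` Z)"
  proof
    fix t assume "t \<in> ball x q"
    then have "circle_of t \<in> U" using q(2) by blast
    then obtain N where "((f_ab a b ^^ p) ^^ N) (circle_of t) = circle_of x"
      using hits by blast
    then have "(lift r b ^^ (p * N)) t \<in> Z"
      by (simp add: funpow_mult r funpow_f_ab_circle_of circle_of_eq_iff Z_def)
    then show "t \<in> (\<Union>N. (lift r b ^^ (p * N)) -` Z)" by auto
  qed
  moreover have "countable ((lift r b ^^ n) -` Z)" for n
  proof (rule countable_image_inj_on)
    show "countable ((lift r b ^^ n) ` ((lift r b ^^ n) -` Z))"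
      by (rule countable_subset[OF _ \<open>countable Z\<close>]) auto
    have "inj (lift r b ^^ n)"
    proof (induction n)
      case 0
      then show ?case by (simp add: id_def)
    next
      case (Suc n)
      show ?case
        using inj_compose[OF inj_lift[OF b(1) \<open>b < 1\<close>] Suc] by (simp only: funpow.simps)
    qed
    then show "inj_on (lift r b ^^ n) ((lift r b ^^ n) -` Z)" by (rule inj_on_subset) auto
  qed
  ultimately have "countable (ball x q)" by (meson countable_UN countable_subset uncountable_def countableI_type)
  then show False using uncountable_ball[OF q(1)] by blast
qed

section \<open>Orbits with prescribed integer parts\<close>

text \<open>The candidate orbit of \<open>x \<in> I_-\<close>: the branch over \<open>I_-\<close> is applied first and the branch
  over \<open>I_+\<close> ever after, and the integer \<open>k j\<close> is subtracted after step \<open>j\<close>. Nothing is reduced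
  modulo 1, so everything is affine in \<open>x\<close> and \<open>a\<close>, and it is an orbit of \<open>f\<close> as
  long as its intermediate points are in \<open>I_+\<close>.\<close>

primrec orb :: "(nat \<Rightarrow> int) \<Rightarrow> real \<Rightarrow> real \<Rightarrow> real \<Rightarrow> nat \<Rightarrow> real" where
  "orb k a b x 0 = x"
| "orb k a b x (Suc j) = (if j = 0 then 2 * (1 - b) * x + 3 * b / 2
      else 2 * (1 + b) * orb k a b x j - b / 2) + a - of_int (k j)"

text \<open>The derivative of \<open>orb k a b x j\<close> with respect to \<open>a\<close>.\<close>

definition slope_sum :: "nat \<Rightarrow> real \<Rightarrow> real" where
  "slope_sum j b = (\<Sum>i<j. (2 * (1 + b)) ^ i)"

text \<open>The value of \<open>a\<close> for which the candidate orbit closes up after \<open>p\<close> steps. Thus the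
  position \<open>x\<close> of the point in \<open>I_-\<close> serves as a coordinate on the parameter space instead
  of \<open>a\<close>.\<close>

definition param :: "nat \<Rightarrow> (nat \<Rightarrow> int) \<Rightarrow> real \<Rightarrow> real \<Rightarrow> real" where
  "param p k x b = ((1 - multiplier p b) * x - orb k 0 b 0 p) / slope_sum p b"

lemma slope_sum_Suc: "slope_sum (Suc j) b = 2 * (1 + b) * slope_sum j b + 1"
  by (simp add: slope_sum_def lessThan_Suc_eq_insert_0 sum.reindex sum_distrib_left)

lemma slope_sum_pos: "b > -1 \<Longrightarrow> p \<ge> 1 \<Longrightarrow> slope_sum p b > 0"
  unfolding slope_sum_def by (rule sum_pos) (auto simp: lessThan_empty_iff)

lemma orb_affine:
  assumes "j \<ge> 1"
  shows "orb k a b x j = orb k 0 b 0 j + multiplier j b * x + a * slope_sum j b"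
  using assms
proof (induction j rule: dec_induct)
  case base
  then show ?case by (simp add: multiplier_def slope_sum_def)
next
  case (step n)
  then show ?case
    by (simp add: multiplier_Suc slope_sum_Suc algebra_simps)
qed

lemma orb_closes_iff:
  assumes "b > -1" "p \<ge> 1"
  shows "orb k a b x p = x \<longleftrightarrow> a = param p k x b"
  using slope_sum_pos[OF assms] orb_affine[OF assms(2), of k a b x]
  by (auto simp: param_def field_simps)

lemma continuous_on_orb_0: "continuous_on S (\<lambda>z. orb k 0 (snd z) 0 j)"
proof (induction j)
  case (Suc j)
  then show ?case by (cases "j = 0") (auto intro!: continuous_intros)
qed simp

lemma continuous_on_param:
  assumes "p \<ge> 1"
  shows "continuous_on (UNIV \<times> {-1<..}) (\<lambda>(x, b). param p k x b)"
proof -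
  have "slope_sum p b \<noteq> 0" if "b > -1" for b
    using slope_sum_pos[of b p] that assms by force
  then show ?thesis
    unfolding case_prod_unfold param_def multiplier_def slope_sum_def
    by (intro continuous_intros continuous_on_orb_0) auto
qed

lemma continuous_on_orb_param:
  assumes "p \<ge> 1"
  shows "continuous_on (UNIV \<times> {-1<..}) (\<lambda>(x, b). orb k (param p k x b) b x j)"
proof (induction j)
  case 0
  then show ?case by (simp add: case_prod_unfold continuous_on_fst)
next
  case (Suc j)
  then show ?case using continuous_on_param[OF assms, of k]
    by (cases "j = 0") (auto simp: case_prod_unfold intro!: continuous_intros)
qed

lemma funpow_f_ab_orb:
  assumes x: "x \<in> {1/2..1}"
    and o: "\<And>j. 1 \<le> j \<Longrightarrow> j < p \<Longrightarrow> orb k a b x j \<in> {0..1/2}"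
    and "j \<le> p"
  shows "(f_ab (circle_of a) b ^^ j) (circle_of x) = circle_of (orb k a b x j)"
  using \<open>j \<le> p\<close>
proof (induction j)
  case (Suc j)
  let ?u = "orb k a b x j"
  have "lift a b ?u = orb k a b x (Suc j) + of_int (k j)"
  proof (cases "j = 0")
    case True
    then show ?thesis using x by (simp add: lift_I_minus)
  next
    case False
    then have "?u \<in> {0..1/2}" using o[of j] Suc.prems by auto
    then show ?thesis using False by (simp add: lift_I_plus)
  qed
  then have "f_ab (circle_of a) b (circle_of ?u) = circle_of (orb k a b x (Suc j))"
    by (simp add: f_ab_circle_of circle_of_eq_iff)
  then show ?case using Suc by simp
qed simp

text \<open>Changing \<open>a\<close> within its class modulo 1 shifts all the integers \<open>k j\<close> simultaneously;
  this is the only ambiguity of \<open>k\<close>.\<close>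

lemma orb_add_const:
  "orb (\<lambda>j. k j + n) (a + of_int n) b x j = orb k a b x j"
  by (induction j) auto

lemma param_add_const:
  assumes "b > -1" "p \<ge> 1"
  shows "param p (\<lambda>j. k j + n) x b = param p k x b + of_int n"
proof -
  have "orb (\<lambda>j. k j + n) (param p k x b + of_int n) b x p = x"
    using orb_closes_iff[OF assms] by (simp add: orb_add_const)
  then show ?thesis using orb_closes_iff[OF assms] by metis
qed

lemma param_cong:
  assumes "\<And>j. j < p \<Longrightarrow> k j = l j"
  shows "param p k x b = param p l x b"
proof -
  have "orb k 0 b 0 j = orb l 0 b 0 j" if "j \<le> p" for j
    using that by (induction j) (auto simp: assms)
  then show ?thesis by (simp add: param_def)
qed

lemma param_less:
  assumes "b > -1" "p \<ge> 1" "multiplier p b < 1" "x < y"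
  shows "param p k x b < param p k y b"
  using assms slope_sum_pos[of b p]
  by (simp add: param_def divide_strict_right_mono)

section \<open>The combinatorial type does not change along a component\<close>

definition attracting_slopes :: "nat \<Rightarrow> real set" where
  "attracting_slopes p = {b \<in> {0..1}. multiplier p b < 1}"

text \<open>Write \<open>h b = (1 + b)^q (1 - b)\<close> with \<open>q = p - 1\<close>, so that the multiplier is \<open>2^p h b\<close>.
  Since \<open>h 0 = 1\<close>, a value of \<open>h\<close> below 1 can be attained only after \<open>h\<close> has started to
  decrease: Bernoulli's inequality turns \<open>h b < 1\<close> into \<open>q (1 - b) < 1\<close>. A second use of
  it shows that \<open>h\<close> does not increase from there on.\<close>

lemma attracting_slopes_upward:
  assumes b: "b \<in> attracting_slopes p" and p: "p \<ge> 1" and c: "b \<le> c" "c \<le> 1"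
  shows "c \<in> attracting_slopes p"
proof -
  define q where "q = p - 1"
  define h where "h u = (1 + u) ^ q * (1 - u)" for u :: real
  have mult: "multiplier p u = 2 ^ p * h u" for u
    unfolding multiplier_def h_def power_mult_distrib q_def[symmetric]
    using p by (cases p) (auto simp: q_def)
  have b01: "0 \<le> b" "b \<le> 1" and "2 ^ p * h b < 1"
    using b by (auto simp: attracting_slopes_def mult)
  have hb0: "h b \<ge> 0" using b01 by (simp add: h_def)
  have "1 * h b \<le> 2 ^ p * h b" using hb0 by (intro mult_right_mono) auto
  with \<open>2 ^ p * h b < 1\<close> have hb: "h b < 1" by simp
  have "h c \<le> h b"
  proof (cases "c = 1")
    case True
    then show ?thesis using hb0 by (simp add: h_def)
  next
    case False
    with c have "c < 1" by simp
    have "1 + of_nat q * b \<le> (1 + b) ^ q" using b01 by (intro Bernoulli_inequality) auto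
    then have "(1 + of_nat q * b) * (1 - b) \<le> h b"
      unfolding h_def using b01 by (intro mult_right_mono) auto
    with hb have "(1 + of_nat q * b) * (1 - b) < 1" by simp
    then have "b * (of_nat q * (1 - b) - 1) < 0" by (simp add: algebra_simps)
    with b01 have q: "of_nat q * (1 - b) < 1" by (auto simp: mult_less_0_iff)
    \<comment> \<open>This makes \<open>1 - s = (1 + b) / (1 + c)\<close>.\<close>
    define s where "s = (c - b) / (1 + c)"
    have s: "0 \<le> s" "s \<le> 1" using c b01 by (auto simp: s_def field_simps)
    have "1 + of_nat q * (- s) \<le> (1 + - s) ^ q"
      using s by (intro Bernoulli_inequality) auto
    moreover have "of_nat q * s \<le> (c - b) / (1 - b)"
    proof -
      have "of_nat q * (1 - b) * (c - b) \<le> 1 * (c - b)"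
        using q c by (intro mult_right_mono) auto
      also have "\<dots> \<le> (1 + c) * (c - b)" using c b01 by (intro mult_right_mono) auto
      finally show ?thesis using c b01 \<open>c < 1\<close> by (simp add: s_def field_simps)
    qed
    ultimately have "1 - (c - b) / (1 - b) \<le> (1 - s) ^ q" by simp
    moreover have "1 - (c - b) / (1 - b) = (1 - c) / (1 - b)"
      using c \<open>c < 1\<close> by (simp add: field_simps)
    moreover have "1 - s = (1 + b) / (1 + c)" using c b01 by (simp add: s_def field_simps)
    ultimately have "(1 - c) / (1 - b) \<le> (1 + b) ^ q / (1 + c) ^ q"
      by (simp add: power_divide)
    then show ?thesis using c b01 \<open>c < 1\<close> by (simp add: h_def field_simps)
  qed
  then have "2 ^ p * h c \<le> 2 ^ p * h b" by (intro mult_left_mono) auto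
  with \<open>2 ^ p * h b < 1\<close> have "2 ^ p * h c < 1" by linarith
  then show ?thesis
    using c b01 by (auto simp: attracting_slopes_def mult)
qed

text \<open>The pairs \<open>(x, b)\<close> that can come from an attracting cycle: all combinatorial types
  share this one connected set.\<close>

definition cell :: "nat \<Rightarrow> (real \<times> real) set" where
  "cell p = {1/2<..<1} \<times> attracting_slopes p"

definition admissible :: "nat \<Rightarrow> (nat \<Rightarrow> int) \<Rightarrow> real \<Rightarrow> real \<Rightarrow> bool" where
  "admissible p k x b \<longleftrightarrow> (\<forall>j. 1 \<le> j \<and> j < p \<longrightarrow> orb k (param p k x b) b x j \<in> {0<..<1/2})"

lemma connected_cell:
  assumes "p \<ge> 1"
  shows "connected (cell p)"
proof -
  have "is_interval (attracting_slopes p)"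
    unfolding is_interval_1
    using attracting_slopes_upward[OF _ assms] by (auto simp: attracting_slopes_def)
  then show ?thesis
    unfolding cell_def by (intro connected_Times) (auto simp: is_interval_connected_1)
qed

text \<open>A point of the orbit that lies in the closed interval \<open>I_+\<close> but not in its interior
  is a break point, hence an end point of \<open>I_-\<close> that is periodic of period \<open>p\<close>; by uniqueness it
  would be \<open>x\<close>.\<close>

lemma orb_not_break:
  assumes p: "p \<ge> 1" and z: "(x, b) \<in> cell p"
    and o: "\<And>j. 1 \<le> j \<Longrightarrow> j < p \<Longrightarrow> orb k (param p k x b) b x j \<in> {0..1/2}"
  shows "admissible p k x b"
proof -
  let ?a = "param p k x b"
  let ?g = "f_ab (circle_of ?a) b"
  have b: "0 \<le> b" "b \<le> 1" "multiplier p b < 1" and x: "1/2 < x" "x < 1"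
    using z by (auto simp: cell_def attracting_slopes_def)
  have orb: "(?g ^^ j) (circle_of x) = circle_of (orb k ?a b x j)" if "j \<le> p" for j
    using x o that by (intro funpow_f_ab_orb) auto
  have "orb k ?a b x p = x" using orb_closes_iff[of b p k ?a x] b p by simp
  then have per: "(?g ^^ p) (circle_of x) = circle_of x" using orb[of p] by simp
  have "orb k ?a b x j \<in> {0<..<1/2}" if j: "1 \<le> j" "j < p" for j
  proof (rule ccontr)
    assume "orb k ?a b x j \<notin> {0<..<1/2}"
    then have "orb k ?a b x j = 0 \<or> orb k ?a b x j = 1/2" using o[OF j] by auto
    \<comment> \<open>On the circle the break point 0 is the right end point 1 of \<open>I_-\<close>.\<close>
    moreover have "circle_of 0 = circle_of 1" by (simp add: circle_of_eq_iff)
    ultimately obtain t where t: "t = 1/2 \<or> t = 1" "circle_of (orb k ?a b x j) = circle_of t"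
      using that[of "1/2"] that[of 1] by metis
    have "(?g ^^ p) (circle_of t) = circle_of t"
      using orb[of j] j t(2) funpow_commute[of p ?g j "circle_of x"] per by simp
    then have "x = t"
      using periodic_point_unique_I_minus[OF b(1,2) p b(3) _ per] x t(1) by auto
    then show False using x t(1) by auto
  qed
  then show ?thesis by (auto simp: admissible_def)
qed

text \<open>Admissibility is an open condition by definition, and a closed one because it may be
  tested with the closed interval. The cell is connected.\<close>

lemma admissible_everywhere:
  assumes p: "p \<ge> 1" and z: "(x, b) \<in> cell p" "admissible p k x b"
    and z': "(x', b') \<in> cell p"
  shows "admissible p k x' b'"
proof -
  let ?o = "\<lambda>j (x, b). orb k (param p k x b) b x j"
  define R where "R = {z \<in> cell p. admissible p k (fst z) (snd z)}"
  have sub: "cell p \<subseteq> UNIV \<times> {-1<..}"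
    by (auto simp: cell_def attracting_slopes_def)
  have cont: "continuous_on (cell p) (?o j)" for j
    using continuous_on_subset[OF continuous_on_orb_param[OF p] sub] .
  have "R = \<Inter> (insert (cell p) ((\<lambda>j. cell p \<inter> ?o j -` {0<..<1/2}) ` {1..<p}))"
    by (auto simp: R_def admissible_def)
  moreover have "openin (top_of_set (cell p)) (cell p \<inter> ?o j -` {0<..<1/2})" for j
    by (rule continuous_openin_preimage_gen[OF cont]) simp
  ultimately have "openin (top_of_set (cell p)) R"
    by (simp only:) (rule openin_Inter, auto)
  moreover have "R = \<Inter> (insert (cell p) ((\<lambda>j. cell p \<inter> ?o j -` {0..1/2}) ` {1..<p}))"
  proof (intro set_eqI iffI)
    fix z assume "z \<in> R"
    then show "z \<in> \<Inter> (insert (cell p) ((\<lambda>j. cell p \<inter> ?o j -` {0..1/2}) ` {1..<p}))"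
      by (cases z) (auto simp: R_def admissible_def less_imp_le)
  next
    fix z assume *: "z \<in> \<Inter> (insert (cell p) ((\<lambda>j. cell p \<inter> ?o j -` {0..1/2}) ` {1..<p}))"
    obtain u c where z: "z = (u, c)" by (cases z)
    have "z \<in> cell p" using * by blast
    moreover have "?o j z \<in> {0..1/2}" if "1 \<le> j" "j < p" for j
      using InterD[OF *, of "cell p \<inter> ?o j -` {0..1/2}"] that by auto
    ultimately show "z \<in> R"
      using orb_not_break[OF p, of u c k] by (simp add: R_def z)
  qed
  moreover have "closedin (top_of_set (cell p)) (cell p \<inter> ?o j -` {0..1/2})" for j
    by (rule continuous_closedin_preimage[OF cont]) simp
  ultimately have "closedin (top_of_set (cell p)) R"
    by (simp only:) (rule closedin_Inter, auto)
  with \<open>openin (top_of_set (cell p)) R\<close> have "R = {} \<or> R = cell p"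
    using connected_cell[OF p] unfolding connected_clopen by blast
  moreover have "(x, b) \<in> R" using z by (simp add: R_def)
  ultimately have "(x', b') \<in> R" using z' by blast
  then show ?thesis by (simp add: R_def)
qed

section \<open>Attracting parameters as a union of cells\<close>

lemma coord_circle_of_eq: "0 \<le> t \<Longrightarrow> t < 1 \<Longrightarrow> coord (circle_of t) = t"
  by (simp add: coord_circle_of frac_eq)

lemma in_I_plus_iff:
  "c \<notin> {circle_of 0, circle_of (1/2)} \<and> c \<in> I_slope Plus \<longleftrightarrow> 0 < coord c \<and> coord c < 1/2"
proof
  assume *: "c \<notin> {circle_of 0, circle_of (1/2)} \<and> c \<in> I_slope Plus"
  then obtain t where t: "t \<in> {0..1/2}" "c = circle_of t" unfolding I_slope.simps by blast
  have "t \<noteq> 0" "t \<noteq> 1/2" using * t(2) by blast+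
  then show "0 < coord c \<and> coord c < 1/2" using t by (simp add: coord_circle_of_eq)
next
  assume *: "0 < coord c \<and> coord c < 1/2"
  have "c \<in> circle_of ` {0..1/2}"
    using * by (intro image_eqI[of _ _ "coord c"]) (auto simp only: circle_of_coord atLeastAtMost_iff)
  moreover have "coord c \<noteq> coord (circle_of 0)" "coord c \<noteq> coord (circle_of (1/2))"
    using * by (simp_all add: coord_circle_of_eq)
  ultimately show "c \<notin> {circle_of 0, circle_of (1/2)} \<and> c \<in> I_slope Plus"
    unfolding I_slope.simps by blast
qed

lemma in_I_minus_iff:
  "c \<notin> {circle_of 0, circle_of (1/2)} \<and> c \<in> I_slope Minus \<longleftrightarrow> 1/2 < coord c"
proof
  assume *: "c \<notin> {circle_of 0, circle_of (1/2)} \<and> c \<in> I_slope Minus"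
  then obtain t where t: "t \<in> {1/2..1}" "c = circle_of t" unfolding I_slope.simps by blast
  have "circle_of 1 = circle_of 0" by (simp add: circle_of_eq_iff)
  then have "t \<noteq> 1" using * t(2) by blast
  moreover have "t \<noteq> 1/2" using * t(2) by blast
  ultimately show "1/2 < coord c" using t by (simp add: coord_circle_of_eq)
next
  assume *: "1/2 < coord c"
  have "c \<in> circle_of ` {1/2..1}"
    using * coord_less_1[of c]
    by (intro image_eqI[of _ _ "coord c"]) (simp_all only: circle_of_coord atLeastAtMost_iff less_imp_le simp_thms)
  moreover have "coord c \<noteq> coord (circle_of 0)" "coord c \<noteq> coord (circle_of (1/2))"
    using * by (simp_all add: coord_circle_of_eq)
  ultimately show "c \<notin> {circle_of 0, circle_of (1/2)} \<and> c \<in> I_slope Minus"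
    unfolding I_slope.simps by blast
qed

lemma single_Minus_position:
  assumes "count_list \<sigma> Minus = 1"
  obtains m where "m < length \<sigma>" "\<And>j. j < length \<sigma> \<Longrightarrow> \<sigma> ! j = (if j = m then Minus else Plus)"
proof -
  have "Minus \<in> set \<sigma>" using assms count_notin by fastforce
  then obtain ys zs where \<sigma>: "\<sigma> = ys @ Minus # zs" by (meson split_list)
  with assms have "Minus \<notin> set ys" "Minus \<notin> set zs" by (auto simp: count_list_0_iff)
  then have "ys ! j = Plus" if "j < length ys" for j
    using that by (metis nth_mem slope.exhaust)
  moreover have "zs ! j = Plus" if "j < length zs" for j
    using that \<open>Minus \<notin> set zs\<close> by (metis nth_mem slope.exhaust)
  ultimately have "\<sigma> ! j = (if j = length ys then Minus else Plus)" if "j < length \<sigma>" for j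
    using that by (auto simp: \<sigma> nth_append nth_Cons split: nat.split)
  then show thesis using that[of "length ys"] by (simp add: \<sigma>)
qed

lemma periodic_admissible_orb:
  assumes p: "p \<ge> 1" and z: "(x, b) \<in> cell p" and ad: "admissible p k x b"
    and g: "g = f_ab (circle_of (param p k x b)) b"
  shows "\<And>j. 1 \<le> j \<Longrightarrow> j < p \<Longrightarrow> coord ((g ^^ j) (circle_of x)) = orb k (param p k x b) b x j"
    and "(g ^^ p) (circle_of x) = circle_of x"
proof -
  let ?a = "param p k x b"
  have x: "1/2 < x" "x < 1" and b: "0 \<le> b" using z by (auto simp: cell_def attracting_slopes_def)
  have o: "orb k ?a b x j \<in> {0<..<1/2}" if "1 \<le> j" "j < p" for j
    using ad that by (auto simp: admissible_def)
  have orb: "(g ^^ j) (circle_of x) = circle_of (orb k ?a b x j)" if "j \<le> p" for j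
    unfolding g using x o that by (intro funpow_f_ab_orb) (auto simp: less_imp_le)
  show "coord ((g ^^ j) (circle_of x)) = orb k ?a b x j" if "1 \<le> j" "j < p" for j
    using orb[of j] o[OF that] that by (simp add: coord_circle_of frac_eq)
  have "orb k ?a b x p = x" using orb_closes_iff[of b p k ?a x] b p by simp
  then show "(g ^^ p) (circle_of x) = circle_of x" using orb[of p] by simp
qed

text \<open>The coordinates in \<open>[0,1)\<close> of the cycle form a candidate orbit, with the integer parts
  of the lifted images as \<open>k\<close>.\<close>

lemma param_of_attracting_cycle:
  assumes p: "p \<ge> 1" and b: "0 \<le> b" "b \<le> 1" and g: "g = f_ab c b"
    and per: "(g ^^ p) y = y"
    and minus: "1/2 < coord y"
    and plus: "\<And>j. 1 \<le> j \<Longrightarrow> j < p \<Longrightarrow> 0 < coord ((g ^^ j) y) \<and> coord ((g ^^ j) y) < 1/2"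
    and U: "open U" "y \<in> U" "\<And>z. z \<in> U \<Longrightarrow> (\<lambda>n. ((g ^^ p) ^^ n) z) \<longlonglongrightarrow> y"
  shows "\<exists>k x. (x, b) \<in> cell p \<and> admissible p k x b \<and> c = circle_of (param p k x b)"
proof -
  define x where "x = coord y"
  have y: "y = circle_of x" by (simp add: x_def circle_of_coord)
  have x: "1/2 < x" "x < 1" using minus coord_less_1[of y] by (auto simp: x_def)
  have "multiplier p b < 1"
    by (rule multiplier_less_1_if_attracting[OF b p x, of c U])
      (use plus per U in \<open>auto simp: g y\<close>)
  then have cell: "(x, b) \<in> cell p" using x b by (auto simp: cell_def attracting_slopes_def)
  define a where "a = coord c"
  have c: "c = circle_of a" by (simp add: a_def circle_of_coord)
  define u where "u j = coord ((g ^^ j) y)" for j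
  define k where "k j = \<lfloor>lift a b (u j)\<rfloor>" for j
  have u_Suc: "u (Suc j) = lift a b (u j) - of_int (k j)" for j
  proof -
    have "(g ^^ Suc j) y = f_ab (circle_of a) b (circle_of (u j))"
      by (simp add: g c u_def circle_of_coord)
    then show ?thesis
      by (simp only: u_def[of "Suc j"] f_ab_circle_of coord_circle_of frac_def k_def)
  qed
  have orb: "orb k a b x j = u j" if "j \<le> p" for j
    using that
  proof (induction j)
    case 0
    then show ?case by (simp add: u_def x_def)
  next
    case (Suc j)
    show ?case
    proof (cases "j = 0")
      case True
      then have "u j = x" by (simp add: u_def x_def)
      then have "lift a b (u j) = 2 * (1 - b) * x + 3 * b / 2 + a"
        using x by (simp add: lift_I_minus)
      then show ?thesis using True by (simp add: u_Suc)
    next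
      case False
      then have "lift a b (u j) = 2 * (1 + b) * u j - b / 2 + a"
        using plus[of j] Suc.prems by (intro lift_I_plus) (auto simp: u_def)
      then show ?thesis using False Suc by (simp add: u_Suc)
    qed
  qed
  have "orb k a b x p = x" using orb[of p] per by (simp add: u_def x_def)
  then have a: "a = param p k x b" using orb_closes_iff[of b p] b p by simp
  have "admissible p k x b"
    unfolding admissible_def a[symmetric] using orb plus by (auto simp: u_def)
  then show ?thesis using cell c a by blast
qed

lemma attracting_cycle_of_param:
  assumes p: "p \<ge> 1" and z: "(x, b) \<in> cell p" and ad: "admissible p k x b"
    and g: "g = f_ab (circle_of (param p k x b)) b" and y: "y = circle_of x"
  shows "exact_period g p y" "attracting_cycle g p ((g ^^ i) y)"
proof -
  have x: "1/2 < x" "x < 1" and b: "0 \<le> b" "b \<le> 1" "multiplier p b < 1"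
    using z by (auto simp: cell_def attracting_slopes_def)
  note per = periodic_admissible_orb[OF p z ad g]
  have cy: "coord y = x" using x by (simp add: y coord_circle_of frac_eq)
  have half: "coord ((g ^^ j) y) < 1/2" if "0 < j" "j < p" for j
    using per(1)[of j] that ad by (simp add: admissible_def y)
  have "(g ^^ j) y \<noteq> y" if "0 < j" "j < p" for j
  proof
    assume eq: "(g ^^ j) y = y"
    show False using half[OF that] cy x unfolding eq by simp
  qed
  then show ex: "exact_period g p y"
    using per(2) p by (simp add: exact_period_def y)
  have "\<exists>U. open U \<and> y \<in> U \<and> (\<forall>z\<in>U. (\<lambda>n. ((g ^^ p) ^^ n) z) \<longlonglongrightarrow> y)"
    unfolding y g
    using attracting_if_multiplier_less_1[OF b(1,2) p b(3) x] per(2) by (simp add: g)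
  then show "attracting_cycle g p ((g ^^ i) y)"
    using attracting_cycle_funpow[OF _ ex] continuous_f_ab[OF b(1)] unfolding g by blast
qed

text \<open>The itinerary \<open>\<sigma>\<close> enters only up to rotation: the orbit may be started at its unique
  point in \<open>I_-\<close>, which is reached at the position \<open>m\<close> of the minus sign.\<close>

lemma attracting_params_iff:
  assumes p: "p \<ge> 1" "length \<sigma> = p" and \<sigma>: "count_list \<sigma> Minus = 1"
  shows "(c, b) \<in> attracting_params \<sigma> \<longleftrightarrow>
    (\<exists>k x. (x, b) \<in> cell p \<and> admissible p k x b \<and> c = circle_of (param p k x b))"
proof -
  define g where "g = f_ab c b"
  obtain m where m: "m < p" "\<And>j. j < p \<Longrightarrow> \<sigma> ! j = (if j = m then Minus else Plus)"
    using single_Minus_position[OF \<sigma>] p(2) by metis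
  show ?thesis
  proof
    assume "(c, b) \<in> attracting_params \<sigma>"
    then obtain x0 where b: "0 \<le> b" "b \<le> 1" and att: "attracting_cycle g p x0"
      and it: "has_itinerary g \<sigma> x0"
      using p(2) by (auto simp: attracting_params_def g_def)
    have ex: "exact_period g p x0" using att by (simp add: attracting_cycle_def)
    then have per: "(g ^^ p) x0 = x0" by (simp add: exact_period_def)
    define y where "y = (g ^^ m) x0"
    obtain U where U: "open U" "y \<in> U" "\<And>z. z \<in> U \<Longrightarrow> (\<lambda>n. ((g ^^ p) ^^ n) z) \<longlonglongrightarrow> y"
      using att m(1) unfolding attracting_cycle_def y_def by blast
    have "1/2 < coord y"
      using it m p(2) in_I_minus_iff[of y] by (auto simp: has_itinerary_def y_def)
    moreover have "0 < coord ((g ^^ j) y) \<and> coord ((g ^^ j) y) < 1/2" if j: "1 \<le> j" "j < p" for j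
    proof -
      let ?i = "(j + m) mod p"
      have "(g ^^ j) y = (g ^^ ?i) x0"
        using funpow_mod_eq[OF per, of "j + m"] by (simp add: y_def funpow_add)
      moreover have "?i < p" "?i \<noteq> m" using j m(1) by (auto simp: mod_if)
      ultimately show ?thesis
        using it m(2) p(2) in_I_plus_iff[of "(g ^^ j) y"] by (auto simp: has_itinerary_def)
    qed
    moreover have "(g ^^ p) y = y"
      using exact_period_funpow[OF ex, of m] by (simp add: y_def exact_period_def)
    ultimately show "\<exists>k x. (x, b) \<in> cell p \<and> admissible p k x b \<and> c = circle_of (param p k x b)"
      using param_of_attracting_cycle[OF p(1) b g_def _ _ _ U] by blast
  next
    assume "\<exists>k x. (x, b) \<in> cell p \<and> admissible p k x b \<and> c = circle_of (param p k x b)"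
    then obtain k x where z: "(x, b) \<in> cell p" and ad: "admissible p k x b"
      and c: "c = circle_of (param p k x b)" by blast
    have g: "g = f_ab (circle_of (param p k x b)) b" by (simp add: g_def c)
    have x: "1/2 < x" "x < 1" and b: "0 \<le> b" "b \<le> 1"
      using z by (auto simp: cell_def attracting_slopes_def)
    define y where "y = circle_of x"
    note cyc = attracting_cycle_of_param[OF p(1) z ad g y_def]
    have per: "(g ^^ p) y = y" using cyc(1) by (simp add: exact_period_def)
    define x0 where "x0 = (g ^^ (p - m)) y"
    have "(g ^^ j) x0 \<notin> {circle_of 0, circle_of (1/2)} \<and> (g ^^ j) x0 \<in> I_slope (\<sigma> ! j)"
      if j: "j < p" for j
    proof -
      let ?i = "(j + (p - m)) mod p"
      have i: "(g ^^ j) x0 = (g ^^ ?i) y"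
        using funpow_mod_eq[OF per, of "j + (p - m)"] by (simp add: x0_def funpow_add)
      show ?thesis
      proof (cases "j = m")
        case True
        then have "(g ^^ j) x0 = y" using i m(1) by simp
        moreover have "coord y = x" using x by (simp add: y_def coord_circle_of frac_eq)
        ultimately show ?thesis
          using True m x in_I_minus_iff[of y] by simp
      next
        case False
        then have "1 \<le> ?i" "?i < p" using j m(1) by (auto simp: mod_if)
        then have "0 < coord ((g ^^ ?i) y) \<and> coord ((g ^^ ?i) y) < 1/2"
          using periodic_admissible_orb(1)[OF p(1) z ad g] ad
          unfolding y_def admissible_def by simp
        then show ?thesis
          using in_I_plus_iff[of "(g ^^ j) x0"] False m(2)[OF j] i by simp
      qed
    qed
    then have "has_itinerary g \<sigma> x0"
      using exact_period_funpow[OF cyc(1)] p(2) by (simp add: has_itinerary_def x0_def)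
    moreover have "attracting_cycle g (length \<sigma>) x0" using cyc(2) p(2) by (simp add: x0_def)
    ultimately show "(c, b) \<in> attracting_params \<sigma>"
      using b by (auto simp: attracting_params_def g_def)
  qed
qed

section \<open>The components\<close>

text \<open>The parameters whose attracting cycle has the combinatorial type \<open>k\<close>, if \<open>k\<close> is
  admissible.\<close>

definition piece :: "nat \<Rightarrow> (nat \<Rightarrow> int) \<Rightarrow> (circle \<times> real) set" where
  "piece p k = (\<lambda>(x, b). (circle_of (param p k x b), b)) ` cell p"

lemma in_pieceI: "(x, b) \<in> cell p \<Longrightarrow> (circle_of (param p k x b), b) \<in> piece p k"
  unfolding piece_def by (rule image_eqI[of _ _ "(x, b)"]) simp_all

lemma continuous_on_piece_map:
  assumes "p \<ge> 1"
  shows "continuous_on (UNIV \<times> {-1<..}) (\<lambda>(x, b). (circle_of (param p k x b), b))"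
proof -
  let ?S = "UNIV \<times> {-1<..} :: (real \<times> real) set"
  have "continuous_on ?S (\<lambda>z. param p k (fst z) (snd z))"
    using continuous_on_param[OF assms, of k] by (simp only: case_prod_unfold)
  then have "continuous_on ?S (\<lambda>z. circle_of (param p k (fst z) (snd z)))"
    by (rule continuous_on_compose2[OF continuous_circle_of]) simp
  then show ?thesis
    unfolding case_prod_unfold
    by (rule continuous_on_Pair) (intro continuous_intros)
qed

lemma connected_piece:
  assumes "p \<ge> 1"
  shows "connected (piece p k)"
  unfolding piece_def
proof (rule connected_continuous_image[OF _ connected_cell[OF assms]])
  show "continuous_on (cell p) (\<lambda>(x, b). (circle_of (param p k x b), b))"
    by (rule continuous_on_subset[OF continuous_on_piece_map[OF assms]])
      (auto simp: cell_def attracting_slopes_def)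
qed

text \<open>The map is affine and increasing in \<open>x\<close>, as the multiplier is below 1.\<close>

lemma image_param:
  assumes p: "p \<ge> 1" and b: "b \<in> attracting_slopes p"
  shows "(\<lambda>x. param p k x b) ` {1/2<..<1} = {param p k (1/2) b<..<param p k 1 b}"
proof -
  have m: "multiplier p b < 1" and b': "b > -1" using b by (auto simp: attracting_slopes_def)
  note less = param_less[OF b' p m]
  have "a \<in> (\<lambda>x. param p k x b) ` {1/2<..<1}"
    if a: "param p k (1/2) b < a" "a < param p k 1 b" for a
  proof -
    \<comment> \<open>The equation \<open>param p k x b = a\<close>, solved for \<open>x\<close>.\<close>
    define x where "x = (a * slope_sum p b + orb k 0 b 0 p) / (1 - multiplier p b)"
    have eq: "param p k x b = a"
      using m slope_sum_pos[OF b' p] by (simp add: param_def x_def)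
    have "x > 1/2" using a less[of x "1/2" k] eq by (cases x "1/2::real" rule: linorder_cases) auto
    moreover have "x < 1" using a less[of 1 x k] eq by (cases x "1::real" rule: linorder_cases) auto
    ultimately show ?thesis using eq by auto
  qed
  then show ?thesis using less by auto
qed

text \<open>For fixed \<open>b\<close>, the piece is the open arc of those \<open>a\<close> between the values for which \<open>x\<close>
  would be 1/2 and 1. Both values are continuous in \<open>b\<close>.\<close>

lemma openin_piece:
  assumes p: "p \<ge> 1" and A: "piece p k \<subseteq> A" "A \<subseteq> UNIV \<times> {0..1}"
  shows "openin (top_of_set A) (piece p k)"
proof -
  let ?h = "\<lambda>z::real \<times> real. (multiplier p (snd z),
    fst z - param p k (1/2) (snd z), param p k 1 (snd z) - fst z)"
  define V where "V = (UNIV \<times> {-1<..}) \<inter> ?h -` ({..<1} \<times> {0<..} \<times> {0<..})"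
  have par: "continuous_on (UNIV \<times> {-1<..}) (\<lambda>z::real \<times> real. param p k x (snd z))" for x
    by (rule continuous_on_compose2[OF continuous_on_param[OF p, of k, unfolded case_prod_unfold],
          of _ "\<lambda>z. (x, snd z)", simplified])
      (auto intro!: continuous_intros)
  have "continuous_on (UNIV \<times> {-1<..}) ?h"
    unfolding multiplier_def by (intro continuous_intros par)
  then have "open V"
    unfolding V_def by (rule continuous_open_preimage) (auto intro!: open_Times)
  then have "open ((\<lambda>(t, b). (circle_of t, b)) ` V)" by (rule open_circle_of_image_prod)
  moreover have "piece p k = A \<inter> (\<lambda>(t, b). (circle_of t, b)) ` V"
  proof (intro set_eqI iffI)
    fix z assume z: "z \<in> piece p k"
    then obtain x b where x: "x \<in> {1/2<..<1}" and b: "b \<in> attracting_slopes p"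
      and zeq: "z = (circle_of (param p k x b), b)"
      by (auto simp: piece_def cell_def)
    have "param p k x b \<in> {param p k (1/2) b<..<param p k 1 b}"
      using x image_param[OF p b, of k] by blast
    then have "(param p k x b, b) \<in> V" using b by (auto simp: V_def attracting_slopes_def)
    then have "z \<in> (\<lambda>(t, b). (circle_of t, b)) ` V"
      by (rule rev_image_eqI) (simp add: zeq)
    then show "z \<in> A \<inter> (\<lambda>(t, b). (circle_of t, b)) ` V" using z A by blast
  next
    fix z assume z: "z \<in> A \<inter> (\<lambda>(t, b). (circle_of t, b)) ` V"
    then obtain a b where ab: "(a, b) \<in> V" and zeq: "z = (circle_of a, b)" by auto
    have b: "b \<in> attracting_slopes p"
      using ab z A(2) zeq by (auto simp: V_def attracting_slopes_def)
    have "a \<in> {param p k (1/2) b<..<param p k 1 b}" using ab by (auto simp: V_def)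
    then obtain x where "x \<in> {1/2<..<1}" "a = param p k x b"
      using image_param[OF p b, of k] by blast
    then show "z \<in> piece p k" using b in_pieceI[of x b p k] by (simp add: zeq cell_def)
  qed
  ultimately show ?thesis by (auto simp: openin_open)
qed

text \<open>A common parameter has only one cycle of period \<open>p\<close> with a point in \<open>I_-\<close>, so the two types describe
  the same orbit and differ at most by the lift chosen for \<open>a\<close>. In that case they yield the same
  circle parameter everywhere, not only at the common one.\<close>

lemma pieces_eq_or_disjoint:
  assumes p: "p \<ge> 1"
    and k: "\<And>x b. (x, b) \<in> cell p \<Longrightarrow> admissible p k x b"
    and l: "\<And>x b. (x, b) \<in> cell p \<Longrightarrow> admissible p l x b"
    and meet: "piece p k \<inter> piece p l \<noteq> {}"
  shows "piece p k = piece p l"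
proof -
  obtain x b x' where z: "(x, b) \<in> cell p" and z': "(x', b) \<in> cell p"
    and eq: "circle_of (param p k x b) = circle_of (param p l x' b)"
    using meet by (auto simp: piece_def)
  have x: "1/2 < x" "x < 1" "1/2 < x'" "x' < 1" and b: "0 \<le> b" "b \<le> 1" "multiplier p b < 1"
    using z z' by (auto simp: cell_def attracting_slopes_def)
  define g where "g = f_ab (circle_of (param p k x b)) b"
  have g': "g = f_ab (circle_of (param p l x' b)) b" by (simp add: g_def eq)
  note perk = periodic_admissible_orb[OF p z k[OF z] g_def]
  note perl = periodic_admissible_orb[OF p z' l[OF z'] g']
  have [simp]: "x' = x"
    using periodic_point_unique_I_minus[OF b(1,2) p b(3), of x' _ x] x perk(2) perl(2)
    by (auto simp: g_def)
  obtain n where n: "param p k x b - param p l x b = of_int n"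
    using eq by (auto simp: circle_of_eq_iff elim: Ints_cases)
  have "orb k (param p k x b) b x j = orb l (param p l x b) b x j" if "j \<le> p" for j
  proof -
    consider "j = 0" | "j = p" | "1 \<le> j" "j < p" using \<open>j \<le> p\<close> by linarith
    then show ?thesis
    proof cases
      case 2
      have "orb i (param p i x b) b x p = x" for i
        by (rule orb_closes_iff[THEN iffD2]) (use b p in auto)
      with 2 show ?thesis by simp
    next
      case 3
      then show ?thesis using perk(1)[of j] perl(1)[of j] by simp
    qed simp
  qed
  note orb_eq = this
  have "k j = l j + n" if "j < p" for j
  proof -
    have "orb k (param p k x b) b x j = orb l (param p l x b) b x j"
      "orb k (param p k x b) b x (Suc j) = orb l (param p l x b) b x (Suc j)"
      using \<open>j < p\<close> by (auto intro!: orb_eq simp del: orb.simps)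
    then have "param p k x b - of_int (k j) = param p l x b - of_int (l j)"
      by (auto split: if_splits)
    with n have "of_int (k j) = (of_int (l j + n) :: real)" by (simp only: of_int_add)
    then show ?thesis by (simp only: of_int_eq_iff)
  qed
  then have "param p k u c = param p l u c + of_int n" if "c > -1" for u c
    using param_cong[of p k "\<lambda>j. l j + n" u c] param_add_const[OF that p, of l n u] by simp
  then have "circle_of (param p k u c) = circle_of (param p l u c)" if "c > -1" for u c
    using that by (simp add: circle_of_eq_iff)
  then show ?thesis unfolding piece_def
    by (intro image_cong) (auto simp: cell_def attracting_slopes_def)
qed

text \<open>The complement of a member is a union of other members, so each member is both open and
  closed.\<close>

lemma components_of_open_partition:
  assumes conn: "\<And>U. U \<in> \<U> \<Longrightarrow> connected U"
    and op: "\<And>U. U \<in> \<U> \<Longrightarrow> openin (top_of_set (\<Union>\<U>)) U"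
    and disj: "pairwise disjnt \<U>"
    and C: "C \<in> components (\<Union>\<U>)"
  shows "C \<in> \<U>"
proof -
  obtain z where "z \<in> C" using C in_components_nonempty by blast
  have CA: "C \<subseteq> \<Union>\<U>" using C by (rule in_components_subset)
  with \<open>z \<in> C\<close> obtain U where U: "U \<in> \<U>" "z \<in> U" by blast
  have UC: "U \<subseteq> C"
    by (rule components_maximal[OF C conn[OF U(1)]]) (use U \<open>z \<in> C\<close> in auto)
  have "\<Union>\<U> - U = \<Union>(\<U> - {U})"
  proof (intro set_eqI iffI)
    fix w assume "w \<in> \<Union>(\<U> - {U})"
    then obtain V where "V \<in> \<U>" "V \<noteq> U" "w \<in> V" by blast
    moreover have "disjnt V U" by (rule pairwiseD[OF disj]) (use calculation U(1) in auto)
    ultimately show "w \<in> \<Union>\<U> - U" by (auto simp: disjnt_iff)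
  qed blast
  moreover have "openin (top_of_set (\<Union>\<U>)) (\<Union>(\<U> - {U}))"
    using op by (intro openin_Union) auto
  ultimately have "closedin (top_of_set (\<Union>\<U>)) U"
    using U(1) by (auto simp: closedin_def)
  then have "closedin (top_of_set C) U"
    using UC CA by (rule closedin_subset_trans)
  moreover have "openin (top_of_set C) U"
    using op[OF U(1)] UC CA by (rule openin_subset_trans)
  ultimately have "U = {} \<or> U = C"
    using in_components_connected[OF C] unfolding connected_clopen by blast
  then show ?thesis using U by auto
qed

lemma one_in_attracting_slopes: "1 \<in> attracting_slopes p"
  by (simp add: attracting_slopes_def multiplier_def)

text \<open>The formula for the piece extends continuously to the compact set
  \<open>[1/2,1] \<times> [0,1]\<close>, whose image is closed; over \<open>b = 1\<close> it adds just the two end points.\<close>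

lemma closure_piece:
  assumes p: "p \<ge> 1"
  shows "closure (piece p k) \<inter> (UNIV \<times> {1})
    = (\<lambda>t. (circle_of t, 1)) ` {param p k (1/2) 1..param p k 1 1}"
proof
  let ?\<Phi> = "\<lambda>(x, b). (circle_of (param p k x b), b)"
  let ?Z = "?\<Phi> ` ({1/2..1} \<times> {0..1})"
  have "compact ?Z"
    by (intro compact_continuous_image continuous_on_subset[OF continuous_on_piece_map[OF p]]
        compact_Times) auto
  then have "closed ?Z" by (rule compact_imp_closed)
  moreover have "piece p k \<subseteq> ?Z"
    unfolding piece_def by (rule image_mono) (auto simp: cell_def attracting_slopes_def)
  ultimately have "closure (piece p k) \<subseteq> ?Z" by (intro closure_minimal)
  moreover have mono: "mono (\<lambda>x. param p k x 1)"
    using p by (intro strict_mono_mono strict_monoI param_less) (auto simp: multiplier_def)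
  have "param p k x 1 \<in> {param p k (1/2) 1..param p k 1 1}" if "x \<in> {1/2..1}" for x
    using that monoD[OF mono, of "1/2" x] monoD[OF mono, of x 1] by simp
  then have "?Z \<inter> (UNIV \<times> {1}) \<subseteq> (\<lambda>t. (circle_of t, 1)) ` {param p k (1/2) 1..param p k 1 1}"
    by auto
  ultimately show "closure (piece p k) \<inter> (UNIV \<times> {1})
      \<subseteq> (\<lambda>t. (circle_of t, 1)) ` {param p k (1/2) 1..param p k 1 1}"
    by blast
next
  let ?h = "\<lambda>t::real. (circle_of t, 1::real)"
  let ?J = "{param p k (1/2) 1<..<param p k 1 1}"
  have "param p k (1/2) 1 < param p k 1 1"
    using p by (intro param_less) (auto simp: multiplier_def)
  then have "{param p k (1/2) 1..param p k 1 1} = closure ?J" by simp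
  moreover have "?h ` closure ?J \<subseteq> closure (?h ` ?J)"
    by (rule continuous_image_closure_subset[of UNIV])
      (auto intro!: continuous_on_Pair continuous_circle_of)
  moreover have "?h ` ?J \<subseteq> piece p k"
    unfolding image_param[OF p one_in_attracting_slopes, symmetric]
    using one_in_attracting_slopes[of p] by (auto intro!: in_pieceI simp: cell_def)
  then have "closure (?h ` ?J) \<subseteq> closure (piece p k)" by (rule closure_mono)
  ultimately show "?h ` {param p k (1/2) 1..param p k 1 1} \<subseteq> closure (piece p k) \<inter> (UNIV \<times> {1})"
    by auto
qed

text \<open>At \<open>b = 1\<close> the multiplier vanishes, so the arc has length \<open>1 / (2 D)\<close>, where
  \<open>D = 1 + 4 + \<dots> + 4^(p-1)\<close>.\<close>

lemma is_tongue_piece: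
  assumes p: "p \<ge> 1"
  shows "is_tongue (piece p k)"
proof -
  have "multiplier p 1 = 0" by (simp add: multiplier_def)
  then have "param p k 1 1 = param p k (1/2) 1 + (1/2) / slope_sum p 1"
    by (simp add: param_def diff_divide_distrib)
  moreover have "slope_sum p 1 \<ge> 1"
    using slope_sum_Suc[of "p - 1" 1] p by (simp add: slope_sum_def sum_nonneg)
  then have "0 < (1/2) / slope_sum p 1" "(1/2) / slope_sum p 1 < 1" by auto
  ultimately show ?thesis
    unfolding is_tongue_def closure_piece[OF p]
    by (intro exI[of _ "param p k (1/2) 1"] exI[of _ "param p k 1 1"]) auto
qed

text \<open>Let \<open>b = 1\<close>. Then \<open>I_-\<close> is mapped to a single point \<open>c\<close>, and \<open>f\<close> is \<open>x \<mapsto> 4 x + c\<close> modulo 1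
  on \<open>I_+\<close>. Hence the \<open>j\<close>-th point of the orbit is \<open>(1 + 4 + \<dots> + 4^(j-1)) c\<close>, and it is enough to choose
  \<open>c\<close> so small that this is 3/4 for \<open>j = p\<close>: the earlier points are at most a quarter of that.
  The values of \<open>k\<close> absorb the shift between \<open>a\<close> and \<open>c\<close>.\<close>

lemma admissible_exists:
  assumes p: "p \<ge> 1"
  shows "admissible p (\<lambda>j. if j = 0 then 1 else - 1) (3/4) 1"
proof -
  define k :: "nat \<Rightarrow> int" where "k = (\<lambda>j. if j = 0 then 1 else - 1)"
  define c where "c = 3 / (4 * slope_sum p 1)"
  have pos: "slope_sum p 1 > 0" using p by (intro slope_sum_pos) auto
  then have "c > 0" by (simp add: c_def)
  have orb: "orb k (c - 1/2) 1 (3/4) j = c * slope_sum j 1" if "j \<ge> 1" for j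
    using that
  proof (induction j rule: dec_induct)
    case base
    then show ?case by (simp add: k_def slope_sum_def)
  next
    case (step n)
    then show ?case by (simp add: k_def slope_sum_Suc algebra_simps)
  qed
  have "orb k (c - 1/2) 1 (3/4) p = 3/4" using orb[OF p] pos by (simp add: c_def)
  then have par: "c - 1/2 = param p k (3/4) 1"
    by (rule orb_closes_iff[THEN iffD1, rotated 2]) (use p in auto)
  have "orb k (c - 1/2) 1 (3/4) j \<in> {0<..<1/2}" if j: "1 \<le> j" "j < p" for j
  proof -
    have "slope_sum (Suc j) 1 \<le> slope_sum p 1"
      unfolding slope_sum_def using j by (intro sum_mono2) auto
    then have "4 * slope_sum j 1 < slope_sum p 1" by (simp add: slope_sum_Suc)
    then have "c * (4 * slope_sum j 1) < c * slope_sum p 1"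
      using \<open>c > 0\<close> by (rule mult_strict_left_mono)
    also have "c * slope_sum p 1 = 3/4" using pos by (simp add: c_def)
    finally show ?thesis
      using orb[OF j(1)] \<open>c > 0\<close> slope_sum_pos[of 1 j] j by simp
  qed
  then show ?thesis unfolding admissible_def k_def[symmetric] par by simp
qed

theorem theorem2p4:
  fixes p :: nat and \<sigma> :: "slope list"
  assumes "p \<ge> 1"
    and "length \<sigma> = p"
    and "count_list \<sigma> Minus = 1"
  shows "attracting_params \<sigma> \<noteq> {} \<and>
         (\<forall>C \<in> components (attracting_params \<sigma>). is_tongue C)"
proof
  note p = assms(1) and iff = attracting_params_iff[OF assms]
  have "(3/4, 1) \<in> cell p" using one_in_attracting_slopes by (simp add: cell_def)
  then show "attracting_params \<sigma> \<noteq> {}"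
    using iff admissible_exists[OF p] by blast
  define K where "K = {k. \<forall>x b. (x, b) \<in> cell p \<longrightarrow> admissible p k x b}"
  have A: "attracting_params \<sigma> = \<Union>(piece p ` K)"
  proof (intro set_eqI iffI)
    fix z assume z_in: "z \<in> attracting_params \<sigma>"
    obtain c b where cb: "z = (c, b)" by (cases z)
    from z_in[unfolded cb iff] obtain k x where z: "(x, b) \<in> cell p" "admissible p k x b"
      "z = (circle_of (param p k x b), b)"
      unfolding cb by blast
    have "k \<in> K" using admissible_everywhere[OF p z(1,2)] by (simp add: K_def)
    moreover have "z \<in> piece p k" using in_pieceI[OF z(1)] z(3) by simp
    ultimately show "z \<in> \<Union>(piece p ` K)" by blast
  next
    fix z assume "z \<in> \<Union>(piece p ` K)"
    then obtain k x b where "k \<in> K" "(x, b) \<in> cell p" "z = (circle_of (param p k x b), b)"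
      by (auto simp: piece_def)
    then show "z \<in> attracting_params \<sigma>"
      unfolding \<open>z = _\<close> iff K_def by blast
  qed
  have sub: "attracting_params \<sigma> \<subseteq> UNIV \<times> {0..1}"
    by (auto simp: attracting_params_def)
  show "\<forall>C \<in> components (attracting_params \<sigma>). is_tongue C"
  proof
    fix C assume "C \<in> components (attracting_params \<sigma>)"
    then have "C \<in> piece p ` K"
      unfolding A
    proof (rule components_of_open_partition[rotated 3])
      show "connected U" if "U \<in> piece p ` K" for U
        using that connected_piece[OF p] by blast
      show "openin (top_of_set (\<Union>(piece p ` K))) U" if "U \<in> piece p ` K" for U
        using that sub A by (auto intro!: openin_piece[OF p])
      show "pairwise disjnt (piece p ` K)"
      proof (rule pairwiseI, elim imageE)
        fix U V k l assume "U \<noteq> V" "U = piece p k" "V = piece p l" "k \<in> K" "l \<in> K"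
        then show "disjnt U V"
          using pieces_eq_or_disjoint[OF p, of k l] unfolding disjnt_def K_def by blast
      qed
    qed
    then show "is_tongue C" using is_tongue_piece[OF p] by blast
  qed
qed

end
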